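(* Let $S\subset\mathbb{R}^n$ be a strictly radially convex set with respect to a point $p\in\operatorname{Int}(S)$ that is in addition a polynomial image of the closed unit ball $\overline{B}_m$, that is, $S=F(\overline{B}_m)$ for some polynomial map $F:\mathbb{R}^m\to\mathbb{R}^n$. Then $S$ is an $m$-brick.
   Context: $\overline{B}_m$ denotes the closed unit ball of $\mathbb{R}^m$ centered at the origin and $\operatorname{Int}$ the topological interior in $\mathbb{R}^n$. A set $S\subset\mathbb{R}^n$ is strictly radially convex with respect to a point $p\in\operatorname{Int}(S)$ if for each ray $\ell$ with origin at $p$, the intersection $\ell\cap S$ is a segment whose relative interior is contained in $\operatorname{Int}(S)$. An $n$-dimensional semialgebraic set $T\subset\mathbb{R}^n$ is an $m$-brick if there exists a homotopy $H=(H_1,\ldots,H_n):[0,1]\times\overline{B}_m\to T$ such that: (1) each $H_i$ is the restriction to $[0,1]\times\overline{B}_m$ of a polynomial of the ring $\mathcal{C}^0([0,1])[x_1,\ldots,x_m]$, where $\mathcal{C}^0([0,1])$ is the ring of continuous real functions on $[0,1]$; (2) $H(\{0\}\times\overline{B}_m)=T$ and $H(1,\cdot)$ is a constant map; (3) $H(\{t\}\times\overline{B}_m)\subset\operatorname{Int}(T)$ for each $t\in(0,1)$. *)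

theory Defs
  imports "HOL-Analysis.Analysis"
begin

(* Polynomial functions and maps are real_polynomial_function and polynomial_function
   (HOL-Analysis.Weierstrass_Theorems). *)

inductive semialgebraic :: "'a::euclidean_space set \<Rightarrow> bool" where
  zero: "real_polynomial_function f \<Longrightarrow> semialgebraic {x. f x = 0}"
| pos: "real_polynomial_function f \<Longrightarrow> semialgebraic {x. f x > 0}"
| compl: "semialgebraic A \<Longrightarrow> semialgebraic (- A)"
| un: "semialgebraic A \<Longrightarrow> semialgebraic B \<Longrightarrow> semialgebraic (A \<union> B)"
| inter: "semialgebraic A \<Longrightarrow> semialgebraic B \<Longrightarrow> semialgebraic (A \<inter> B)"

definition semialgebraic_map_on ::
    "'a::euclidean_space set \<Rightarrow> ('a \<Rightarrow> 'b::euclidean_space) \<Rightarrow> bool" where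
  "semialgebraic_map_on A f \<longleftrightarrow> semialgebraic {(x, f x) |x. x \<in> A}"

(* The open cube (0,1)^d with d = card K, placed in the coordinate subspace of R^n spanned by
   the axes in K; this realises every (0,1)^d with d \<le> n without a dimension-indexed type. *)
definition open_cube :: "'n::finite set \<Rightarrow> (real^'n) set" where
  "open_cube K = {x. (\<forall>i\<in>K. 0 < x $ i \<and> x $ i < 1) \<and> (\<forall>i. i \<notin> K \<longrightarrow> x $ i = 0)}"

(* Basu, Pollack, Roy, Algorithms in Real Algebraic Geometry, Section 5.3: the largest d such that
   there is an injective semialgebraic map from (0,1)^d to S, with dimension -1 for the empty set.
   Only d \<le> n has to be considered, since no such map exists into R^n for d > n. *)
definition semialgebraic_dim :: "(real^'n::finite) set \<Rightarrow> int" where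
  "semialgebraic_dim S =
    (if S = {} then - 1
     else int (Max {card K |K :: 'n set. \<exists>f :: real^'n \<Rightarrow> real^'n.
       semialgebraic_map_on (open_cube K) f \<and> inj_on f (open_cube K) \<and> f ` open_cube K \<subseteq> S}))"

definition ray :: "'a::real_vector \<Rightarrow> 'a \<Rightarrow> 'a set" where
  "ray p v = {p + s *\<^sub>R v |s. s \<ge> 0}"

definition strictly_radially_convex :: "(real^'n::finite) set \<Rightarrow> real^'n \<Rightarrow> bool" where
  "strictly_radially_convex S p \<longleftrightarrow>
     p \<in> interior S \<and>
     (\<forall>v. v \<noteq> 0 \<longrightarrow>
        (\<exists>a b. ray p v \<inter> S = closed_segment a b \<and>
               rel_interior (closed_segment a b) \<subseteq> interior S))"

(* h is the restriction to [0,1] x B of an element of C^0([0,1])[x_1,...,x_m], written as a finite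
   sum of monomials; A is its set of exponents and c \<alpha> the coefficient function at \<alpha>. *)
definition C0_polynomial_on_ball :: "(real \<times> (real^'m::finite) \<Rightarrow> real) \<Rightarrow> bool" where
  "C0_polynomial_on_ball h \<longleftrightarrow>
     (\<exists>(A :: ('m \<Rightarrow> nat) set) c. finite A \<and> (\<forall>\<alpha>\<in>A. continuous_on {0..1} (c \<alpha>)) \<and>
        (\<forall>t\<in>{0..1}. \<forall>x\<in>cball 0 1. h (t, x) = (\<Sum>\<alpha>\<in>A. c \<alpha> t * (\<Prod>j\<in>UNIV. x $ j ^ \<alpha> j))))"

(* The number m of an m-brick is passed as the index type: m = CARD('m). *)
definition brick :: "'m::finite itself \<Rightarrow> (real^'n::finite) set \<Rightarrow> bool" where
  "brick (_ :: 'm itself) T \<longleftrightarrow>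
     semialgebraic T \<and> semialgebraic_dim T = int CARD('n) \<and>
     (\<exists>H :: real \<times> (real^'m) \<Rightarrow> real^'n.
        continuous_on ({0..1} \<times> cball 0 1) H \<and> H ` ({0..1} \<times> cball 0 1) \<subseteq> T \<and>
        (\<forall>i. C0_polynomial_on_ball (\<lambda>z. H z $ i)) \<and>
        H ` ({0} \<times> cball 0 1) = T \<and>
        (\<exists>q. \<forall>x\<in>cball 0 1. H (1, x) = q) \<and>
        (\<forall>t\<in>{0<..<1}. H ` ({t} \<times> cball 0 1) \<subseteq> interior T))"

end

theory Submission
  imports Defs "HOL-Computational_Algebra.Polynomial" "HOL-Library.Multiset"
begin

text \<open>
  The homotopy is the radial contraction \<open>H (t, x) = t p + (1 - t) F x\<close>. Its components are
  polynomial in \<open>x\<close> with coefficients continuous in \<open>t\<close>; at \<open>t = 0\<close> it parametrises \<open>S\<close>, at \<open>t = 1\<close> it is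
  the constant \<open>p\<close>, and for \<open>0 < t < 1\<close> strict radial convexity puts its image into the interior
  (\<open>strictly_radially_convex_contraction\<close>). The dimension of \<open>S\<close> is full because \<open>p\<close> is an interior
  point (\<open>semialgebraic_dim_interior\<close>).

  The substantial point is that the polynomial image \<open>S\<close> is semialgebraic, an instance of the
  Tarski-Seidenberg theorem. The image is the projection of the graph of \<open>F\<close> over the ball, and since
  the ball lies in a cube, it suffices to project along segments parametrised by \<open>[-1,1]\<close>
  (\<open>semialgebraic_segment_projection\<close>). The argument for one such projection is the elimination method
  of Cohen and Hormander, in a form without sign tables. Two values of the parameter are equivalent
  if an order automorphism of \<open>[-1,1]\<close> carries the signs of the specialised polynomials at one value
  to those at the other. The parameter space is covered by finitely many semialgebraic sets, each
  contained in one equivalence class (\<open>finite_semialgebraic_sign_types\<close>), and since equivalent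
  parameters agree on whether a system of sign conditions is solvable, the projection is a union of
  some of these sets.

  The covering is found by induction on degrees. A polynomial of maximal degree is traded for its
  derivative, its values at \<open>-1\<close> and \<open>1\<close>, and its remainders modulo the other polynomials and modulo its
  derivative. The new family determines the signs of the old polynomial at all roots of the others and
  at its own critical points; between these it is strictly monotone, so its roots and signs are
  determined as well (\<open>add_polynomial_to_matching\<close>).
\<close>

section \<open>Signs of real polynomials in one variable\<close>

lemma poly_of_degree_zero: "degree (p :: real poly) = 0 \<Longrightarrow> poly p x = coeff p 0"
  by (simp add: poly_altdef)

lemma sgn_poly_eq_if_no_root:
  fixes p :: "real poly"
  assumes "a \<le> b" "\<And>x. a \<le> x \<Longrightarrow> x \<le> b \<Longrightarrow> poly p x \<noteq> 0"
  shows "sgn (poly p a) = sgn (poly p b)"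
proof (rule ccontr)
  assume ne: "\<not> ?thesis"
  have "poly p a \<noteq> 0" "poly p b \<noteq> 0" using assms by auto
  with ne have "(poly p a < 0 \<and> 0 < poly p b) \<or> (0 < poly p a \<and> poly p b < 0)"
    by (auto simp: sgn_if split: if_splits)
  moreover from ne assms(1) have "a < b" by (cases "a = b") auto
  ultimately obtain x where "a < x" "x < b" "poly p x = 0"
    using poly_IVT_pos[of a b p] poly_IVT_neg[of a b p] by blast
  with assms(2)[of x] show False by simp
qed

lemma sgn_poly_after_root:
  fixes p :: "real poly"
  assumes "a < b" "poly p a = 0" "\<And>x. a < x \<Longrightarrow> x \<le> b \<Longrightarrow> poly (pderiv p) x \<noteq> 0"
  shows "sgn (poly p b) = sgn (poly (pderiv p) b)"
proof -
  obtain x where x: "a < x" "x < b" "poly p b - poly p a = (b - a) * poly (pderiv p) x"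
    using poly_MVT[OF assms(1)] by blast
  have "sgn (poly p b) = sgn (poly (pderiv p) x)"
    using x assms by (simp add: sgn_mult)
  also have "\<dots> = sgn (poly (pderiv p) b)"
    using x assms(3) by (intro sgn_poly_eq_if_no_root) auto
  finally show ?thesis .
qed

lemma sgn_poly_before_root:
  fixes p :: "real poly"
  assumes "a < b" "poly p b = 0" "\<And>x. a < x \<Longrightarrow> x \<le> b \<Longrightarrow> poly (pderiv p) x \<noteq> 0"
  shows "sgn (poly p a) = - sgn (poly (pderiv p) b)"
proof -
  obtain x where x: "a < x" "x < b" "poly p b - poly p a = (b - a) * poly (pderiv p) x"
    using poly_MVT[OF assms(1)] by blast
  have "poly p a = - ((b - a) * poly (pderiv p) x)" using x assms by simp
  then have "sgn (poly p a) = - sgn (poly (pderiv p) x)"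
    using assms(1) by (simp only: sgn_minus) (simp add: sgn_mult)
  also have "sgn (poly (pderiv p) x) = sgn (poly (pderiv p) b)"
    using x assms(3) by (intro sgn_poly_eq_if_no_root) auto
  finally show ?thesis .
qed

lemma rolle_poly:
  fixes p :: "real poly"
  assumes "a < b" "poly p a = 0" "poly p b = 0"
  obtains x where "a < x" "x < b" "poly (pderiv p) x = 0"
proof -
  obtain x where x: "a < x" "x < b" "poly p b - poly p a = (b - a) * poly (pderiv p) x"
    using poly_MVT[OF assms(1)] by blast
  then show ?thesis using that assms by auto
qed

text \<open>
  A matching of finitely many marked points is all that has to be constructed by hand: between
  marked points the correspondence is immaterial. The extension is built from left to right, each
  new rightmost point replacing everything beyond its predecessor by an affine piece.
\<close>

lemma strict_mono_on_finite_extends: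
  fixes f :: "real \<Rightarrow> real"
  assumes "finite X" "strict_mono_on X f"
  shows "\<exists>g. strict_mono g \<and> surj g \<and> (\<forall>x\<in>X. g x = f x)"
  using assms
proof (induction X rule: finite_linorder_max_induct)
  case empty
  show ?case by (intro exI[of _ id]) (auto simp: strict_mono_def)
next
  case (insert b X)
  then have smX: "strict_mono_on X f"
    by (auto intro: monotone_on_subset)
  show ?case
  proof (cases "X = {}")
    case True
    have "surj (\<lambda>z. z - b + f b)" by (rule surjI[of _ "\<lambda>w. w + b - f b"]) simp
    with True show ?thesis
      by (intro exI[of _ "\<lambda>z. z - b + f b"]) (auto simp: strict_mono_def)
  next
    case False
    obtain g where g: "strict_mono g" "surj g" "\<forall>x\<in>X. g x = f x"
      using insert.IH[OF smX] by blast
    define u where "u = Max X"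
    have uX: "u \<in> X" and u_max: "\<And>x. x \<in> X \<Longrightarrow> x \<le> u"
      using False insert.hyps by (auto simp: u_def)
    have ub: "u < b" using uX insert.hyps by auto
    have fub: "f u < f b" using insert.prems uX ub by (auto simp: strict_mono_on_def)
    define s where "s = (f b - f u) / (b - u)"
    have s: "s > 0" "f u + s * (b - u) = f b" using ub fub by (auto simp: s_def)
    define h where "h = (\<lambda>z. if z \<le> u then g z else f u + s * (z - u))"
    have "strict_mono h"
    proof (rule strict_monoI)
      fix x y :: real assume xy: "x < y"
      consider "y \<le> u" | "x \<le> u" "u < y" | "u < x" by linarith
      then show "h x < h y"
      proof cases
        case 1 then show ?thesis using xy g(1) by (auto simp: h_def strict_mono_def)
      next
        case 2
        have "g x \<le> g u" using 2 g(1) by (simp add: strict_mono_less_eq)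
        also have "\<dots> = f u" using g(3) uX by auto
        also have "\<dots> < f u + s * (y - u)" using s 2 by simp
        finally show ?thesis using 2 by (simp add: h_def)
      next
        case 3 then show ?thesis using xy s by (simp add: h_def)
      qed
    qed
    moreover have "surj h"
    proof (rule surjI)
      fix w
      show "h (if w \<le> f u then inv g w else u + (w - f u) / s) = w"
      proof (cases "w \<le> f u")
        case True
        have "g (inv g w) = w" by (simp add: surj_f_inv_f g(2))
        moreover have "g u = f u" using g(3) uX by auto
        ultimately have "inv g w \<le> u" using True g(1) by (metis strict_mono_less_eq)
        then show ?thesis using True \<open>g (inv g w) = w\<close> by (simp add: h_def)
      next
        case False
        define v where "v = (w - f u) / s"
        have "v > 0" "s * v = w - f u" using False s by (auto simp: v_def)
        then show ?thesis using False by (simp add: h_def flip: v_def)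
      qed
    qed
    moreover have "\<forall>x\<in>insert b X. h x = f x"
      using g(3) u_max ub s by (auto simp: h_def)
    ultimately show ?thesis by blast
  qed
qed

lemma finite_neighbours:
  fixes C :: "real set"
  assumes "finite C" "l \<in> C" "u \<in> C" "l \<le> r" "r \<le> u" "r \<notin> C"
  obtains a b where "a \<in> C" "b \<in> C" "a < r" "r < b" "\<And>c. c \<in> C \<Longrightarrow> c \<le> a \<or> b \<le> c"
proof -
  let ?A = "{c\<in>C. c < r}" and ?B = "{c\<in>C. r < c}"
  have "l < r" "r < u" using assms by (metis order_le_less)+
  then have "l \<in> ?A" "u \<in> ?B" using assms by auto
  then have "Max ?A \<in> ?A" "Min ?B \<in> ?B" using assms(1)
    by (intro Max_in Min_in; auto)+
  moreover have "c \<le> Max ?A \<or> Min ?B \<le> c" if "c \<in> C" for c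
  proof -
    have "c < r \<or> r < c" using that assms(6) by (metis linorder_cases)
    then show ?thesis using that assms(1) by (auto intro: Max_ge Min_le)
  qed
  ultimately show ?thesis using that[of "Max ?A" "Min ?B"] by blast
qed

text \<open>
  Suppose \<open>\<psi>\<close> matches a finite set \<open>C\<close> that contains the critical points of \<open>f\<close> between its ends, and along which \<open>f\<close>
  and \<open>g\<close> have equal signs. A root \<open>r\<close> of \<open>f\<close> outside \<open>C\<close> lies in a gap of \<open>C\<close> on which \<open>f\<close> is strictly
  monotone, so \<open>f\<close> has opposite signs at the two ends of the gap, hence so has \<open>g\<close> at the matched
  ends, and \<open>g\<close> has a root in the matched gap. That gap is described by comparing \<open>r'\<close> with the
  image of every point of \<open>C\<close>, a form that needs no enumeration of \<open>C\<close>. Applied in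
  both directions, the lemma gives a bijection between the roots outside the matched sets.
\<close>

lemma root_transfer:
  fixes f g :: "real poly" and \<psi> :: "real \<Rightarrow> real"
  assumes fin: "finite C" and lu: "l \<in> C" "u \<in> C"
    and mono: "strict_mono_on C \<psi>"
    and crit: "\<And>x. l \<le> x \<Longrightarrow> x \<le> u \<Longrightarrow> poly (pderiv f) x = 0 \<Longrightarrow> x \<in> C"
    and sg: "\<And>c. c \<in> C \<Longrightarrow> sgn (poly f c) = sgn (poly g (\<psi> c))"
    and r: "l \<le> r" "r \<le> u" "poly f r = 0" "r \<notin> C"
    and bd: "\<And>c. c \<in> C \<Longrightarrow> l \<le> c \<and> c \<le> u"
  shows "\<exists>r'. poly g r' = 0 \<and> (\<forall>c\<in>C. (c < r \<longrightarrow> \<psi> c < r') \<and> (r < c \<longrightarrow> r' < \<psi> c))"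
proof -
  obtain a b where ab: "a \<in> C" "b \<in> C" "a < r" "r < b" and nb: "\<And>c. c \<in> C \<Longrightarrow> c \<le> a \<or> b \<le> c"
    using finite_neighbours[OF fin lu r(1,2,4)] by metis
  have no: "poly (pderiv f) x \<noteq> 0" if "a < x" "x < b" for x
    using that nb[of x] crit[of x] bd[OF ab(1)] bd[OF ab(2)] by auto
  define s where "s = sgn (poly (pderiv f) r)"
  have s: "s \<noteq> 0" using no[OF ab(3,4)] by (simp add: s_def sgn_0_0)
  have sa: "sgn (poly f a) = - s"
    unfolding s_def using ab r(3) no by (intro sgn_poly_before_root) auto
  obtain x where x: "r < x" "x < b" "poly f b - poly f r = (b - r) * poly (pderiv f) x"
    using poly_MVT[OF ab(4)] by blast
  have "sgn (poly f b) = sgn (poly (pderiv f) x)"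
    using x(3) r(3) ab(4) by (simp add: sgn_mult)
  also have "\<dots> = s" unfolding s_def
    using x ab no by (intro sgn_poly_eq_if_no_root[symmetric]) auto
  finally have sb: "sgn (poly f b) = s" .
  have "\<psi> a < \<psi> b" using mono ab by (auto simp: strict_mono_on_def)
  moreover have "sgn (poly g (\<psi> a)) = - s" "sgn (poly g (\<psi> b)) = s"
    using sa sb sg ab by auto
  moreover have "s = 1 \<or> s = -1" using s by (auto simp: s_def sgn_if)
  ultimately have "\<exists>r'. \<psi> a < r' \<and> r' < \<psi> b \<and> poly g r' = 0"
    using poly_IVT_pos[of "\<psi> a" "\<psi> b" g] poly_IVT_neg[of "\<psi> a" "\<psi> b" g]
    by (auto simp: sgn_1_pos sgn_1_neg)
  then obtain r' where r': "\<psi> a < r'" "r' < \<psi> b" "poly g r' = 0" by blast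
  have "\<psi> c < r'" if "c \<in> C" "c < r" for c
  proof -
    have "c \<le> a" using nb[OF that(1)] that ab by auto
    then have "\<psi> c \<le> \<psi> a" using mono ab that by (metis order_le_less strict_mono_onD)
    then show ?thesis using r' by simp
  qed
  moreover have "r' < \<psi> c" if "c \<in> C" "r < c" for c
  proof -
    have "b \<le> c" using nb[OF that(1)] that ab by auto
    then have "\<psi> b \<le> \<psi> c" using mono ab that by (metis order_le_less strict_mono_onD)
    then show ?thesis using r' by simp
  qed
  ultimately show ?thesis using r' by blast
qed

section \<open>Extending a matching of sign patterns by one more polynomial\<close>

text \<open>
  The order automorphisms of \<open>[-1,1]\<close>; values outside that interval are irrelevant. Working over a
  compact interval makes both ends ordinary marked points, so the behaviour of polynomials at
  infinity never enters.
\<close>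

definition order_bij :: "(real \<Rightarrow> real) \<Rightarrow> bool" where
  "order_bij \<psi> \<longleftrightarrow> strict_mono_on {-1..1} \<psi> \<and> \<psi> ` {-1..1} = {-1..1}"

lemma order_bij_less_iff:
  assumes "order_bij \<psi>" "x \<in> {-1..1}" "y \<in> {-1..1}"
  shows "\<psi> x < \<psi> y \<longleftrightarrow> x < y"
  using assms strict_mono_on_less unfolding order_bij_def by blast

lemma order_bij_mem: "order_bij \<psi> \<Longrightarrow> x \<in> {-1..1} \<Longrightarrow> \<psi> x \<in> {-1..1}"
  unfolding order_bij_def by blast

lemma order_bij_surj:
  assumes "order_bij \<psi>" "y \<in> {-1..1}"
  obtains x where "x \<in> {-1..1}" "\<psi> x = y"
  using assms unfolding order_bij_def by (metis imageE)

lemma order_bij_ends: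
  assumes "order_bij \<psi>" shows "\<psi> (-1) = -1" "\<psi> 1 = 1"
proof -
  obtain x where x: "x \<in> {-1..1}" "\<psi> x = -1" using order_bij_surj[OF assms, of "-1"] by auto
  show "\<psi> (-1) = -1"
  proof (cases "x = -1")
    case False
    then have "\<psi> (-1) < \<psi> x" using x order_bij_less_iff[OF assms, of "-1" x] by auto
    then show ?thesis using x order_bij_mem[OF assms, of "-1"] by auto
  qed (use x in auto)
  obtain x where x: "x \<in> {-1..1}" "\<psi> x = 1" using order_bij_surj[OF assms, of 1] by auto
  show "\<psi> 1 = 1"
  proof (cases "x = 1")
    case False
    then have "\<psi> x < \<psi> 1" using x order_bij_less_iff[OF assms, of x 1] by auto
    then show ?thesis using x order_bij_mem[OF assms, of 1] by auto
  qed (use x in auto)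
qed

lemma order_bij_restrict:
  assumes "strict_mono \<psi>" "surj \<psi>" "\<psi> (-1) = -1" "\<psi> 1 = 1"
  shows "order_bij \<psi>"
  unfolding order_bij_def
proof
  show "strict_mono_on {-1..1} \<psi>" using assms(1) by (auto intro: monotone_on_subset)
  have le: "\<psi> x \<le> \<psi> y \<longleftrightarrow> x \<le> y" for x y using assms(1) by (simp add: strict_mono_less_eq)
  have "-1 \<le> \<psi> x \<longleftrightarrow> -1 \<le> x" "\<psi> x \<le> 1 \<longleftrightarrow> x \<le> 1" for x
    using le[of "-1" x] le[of x 1] assms(3,4) by auto
  moreover have "\<exists>x. y = \<psi> x" for y using assms(2) by (metis surjD)
  ultimately show "\<psi> ` {-1..1} = {-1..1}" by (auto simp: image_iff Bex_def) (metis)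
qed

text \<open>
  The geometric heart of quantifier elimination. The families \<open>p\<close> and \<open>q\<close> have the same sign pattern
  along \<open>[-1,1]\<close> up to \<open>\<psi>\<close>, and they contain the derivatives of \<open>f\<close> and \<open>g\<close>. If \<open>f\<close> and \<open>g\<close> have equal
  signs at the marked points \<open>C\<close>, which include the two ends and all roots of the nonconstant
  members, then \<open>f\<close> and \<open>g\<close> can be included. Each gap of
  \<open>C\<close> contains at most one root of \<open>f\<close> by Rolle, and it contains one exactly if the matched gap contains one of \<open>g\<close>; the new \<open>\<psi>'\<close> keeps \<open>\<psi>\<close> on \<open>C\<close> and sends the new roots to
  each other. The old signs survive since they are constant on the gaps of \<open>C\<close>. In a gap between
  consecutive marked points and roots, the sign of \<open>f\<close> is its sign at the left end or, if that
  vanishes, the sign of its derivative.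
\<close>

lemma add_polynomial_to_matching:
  fixes p q :: "'i \<Rightarrow> real poly" and f g :: "real poly"
  assumes \<psi>: "order_bij \<psi>"
    and sgI: "\<And>i x. i \<in> I \<Longrightarrow> x \<in> {-1..1} \<Longrightarrow> sgn (poly (p i) x) = sgn (poly (q i) (\<psi> x))"
    and C: "finite C" "C \<subseteq> {-1..1}" "-1 \<in> C" "1 \<in> C"
    and rootsI: "\<And>i. i \<in> I \<Longrightarrow> (\<forall>x\<in>{-1..1}. poly (p i) x = 0 \<longrightarrow> x \<in> C) \<or> (degree (p i) = 0 \<and> degree (q i) = 0)"
    and d: "d \<in> I" "p d = pderiv f" "q d = pderiv g" "\<And>x. x \<in> {-1..1} \<Longrightarrow> poly (pderiv f) x = 0 \<Longrightarrow> x \<in> C"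
    and sgC: "\<And>c. c \<in> C \<Longrightarrow> sgn (poly f c) = sgn (poly g (\<psi> c))"
    and f0: "f \<noteq> 0"
  shows "\<exists>\<psi>'. order_bij \<psi>' \<and> (\<forall>x\<in>{-1..1}. (\<forall>i\<in>I. sgn (poly (p i) x) = sgn (poly (q i) (\<psi>' x)))
      \<and> sgn (poly f x) = sgn (poly g (\<psi>' x)))"
proof -
  note less = order_bij_less_iff[OF \<psi>] and mem = order_bij_mem[OF \<psi>]
  have CI: "c \<in> {-1..1}" if "c \<in> C" for c using C(2) that by blast
  have \<psi>C: "strict_mono_on C \<psi>" using \<psi> C(2) unfolding order_bij_def by (auto intro: monotone_on_subset)
  have sgd: "x \<in> {-1..1} \<Longrightarrow> sgn (poly (pderiv f) x) = sgn (poly (pderiv g) (\<psi> x))" for x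
    using sgI[OF d(1)] d(2,3) by simp
  have critg: "y \<in> \<psi> ` C" if y: "y \<in> {-1..1}" "poly (pderiv g) y = 0" for y
  proof -
    obtain x where "x \<in> {-1..1}" "\<psi> x = y" using order_bij_surj[OF \<psi> y(1)] by blast
    then show ?thesis using sgd[of x] y d(4)[of x] by (auto simp: sgn_0_0)
  qed
  (* The roots of f that are not yet marked, with partners \<rho> among the roots of g. *)
  define R where "R = {r\<in>{-1..1}. poly f r = 0} - C"
  have "finite R"
    using poly_roots_finite[OF f0] by (auto simp: R_def intro: finite_subset)
  have RI: "r \<in> {-1..1}" "poly f r = 0" "r \<notin> C" if "r \<in> R" for r using that by (auto simp: R_def)
  have "\<exists>r'. poly g r' = 0 \<and> (\<forall>c\<in>C. (c < r \<longrightarrow> \<psi> c < r') \<and> (r < c \<longrightarrow> r' < \<psi> c))" if "r \<in> R" for r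
    using RI[OF that] C(2) d(4) sgC by (intro root_transfer[OF C(1,3,4) \<psi>C]) auto
  then obtain \<rho> where \<rho>0: "\<And>r. r \<in> R \<Longrightarrow> poly g (\<rho> r) = 0"
    and \<rho>l: "\<And>r c. r \<in> R \<Longrightarrow> c \<in> C \<Longrightarrow> c < r \<Longrightarrow> \<psi> c < \<rho> r"
    and \<rho>u: "\<And>r c. r \<in> R \<Longrightarrow> c \<in> C \<Longrightarrow> r < c \<Longrightarrow> \<rho> r < \<psi> c" by metis
  define \<phi> where "\<phi> = (\<lambda>x. if x \<in> C then \<psi> x else \<rho> x)"
  define D where "D = C \<union> R"
  have finD: "finite D" using C(1) \<open>finite R\<close> by (simp add: D_def)
  have "strict_mono_on D \<phi>"
  proof (rule strict_mono_onI)
    fix r s assume rs: "r \<in> D" "s \<in> D" "r < s"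
    show "\<phi> r < \<phi> s"
    proof (cases "r \<in> C \<or> s \<in> C")
      case True
      then show ?thesis using rs \<rho>l \<rho>u RI strict_mono_onD[OF \<psi>C] by (auto simp: \<phi>_def D_def)
    next
      case False
      then have R: "r \<in> R" "s \<in> R" using rs by (auto simp: D_def)
      obtain c where c: "r < c" "c < s" "poly (pderiv f) c = 0"
        using rolle_poly[of r s f] rs(3) RI R by blast
      have "c \<in> C" using d(4)[of c] c RI(1)[OF R(1)] RI(1)[OF R(2)] by auto
      then have "\<rho> r < \<rho> s" using \<rho>l[OF R(2) _ c(2)] \<rho>u[OF R(1) _ c(1)] by force
      then show ?thesis using False by (simp add: \<phi>_def)
    qed
  qed
  then obtain \<psi>' where \<psi>'0: "strict_mono \<psi>'" "surj \<psi>'" "\<And>x. x \<in> D \<Longrightarrow> \<psi>' x = \<phi> x"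
    using strict_mono_on_finite_extends[OF finD] by blast
  have onC: "\<psi>' c = \<psi> c" if "c \<in> C" for c using that \<psi>'0(3)[of c] by (simp add: D_def \<phi>_def)
  have \<psi>': "order_bij \<psi>'"
    using onC C(3,4) order_bij_ends[OF \<psi>] by (intro order_bij_restrict[OF \<psi>'0(1,2)]) auto
  have "\<psi> ` C = \<psi>' ` C" using onC by (intro image_cong) auto
  then have CD: "C \<subseteq> D" "\<psi> ` C \<subseteq> \<psi>' ` D" by (auto simp: D_def)
  have less': "\<psi>' x < \<psi>' y \<longleftrightarrow> x < y" for x y using \<psi>'0(1) by (simp add: strict_mono_less)
  (* Nothing is missed on the side of g: transferring a root y of g back gives a root r of f,
     and by Rolle y is the only root of g in its gap, so y is the partner of r. *)
  have rootsg: "y \<in> \<psi>' ` D" if y: "y \<in> {-1..1}" "poly g y = 0" for y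
  proof (cases "y \<in> \<psi> ` C")
    case True
    then show ?thesis using CD by blast
  next
    case False
    define \<theta> where "\<theta> = inv_into C \<psi>"
    have inj: "inj_on \<psi> C" using \<psi>C strict_mono_on_imp_inj_on by blast
    have \<theta>: "\<theta> (\<psi> c) = c" if "c \<in> C" for c using that inj by (simp add: \<theta>_def)
    have m\<theta>: "strict_mono_on (\<psi> ` C) \<theta>"
      by (rule strict_mono_onI) (use \<theta> less CI in auto)
    have "\<exists>r. poly f r = 0 \<and> (\<forall>c\<in>\<psi> ` C. (c < y \<longrightarrow> \<theta> c < r) \<and> (y < c \<longrightarrow> r < \<theta> c))"
    proof (rule root_transfer[OF _ _ _ m\<theta>])
      show "finite (\<psi> ` C)" using C(1) by simp
      show "-1 \<in> \<psi> ` C" "1 \<in> \<psi> ` C" using C(3,4) order_bij_ends[OF \<psi>] by (metis imageI)+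
      show "\<And>x. - 1 \<le> x \<Longrightarrow> x \<le> 1 \<Longrightarrow> poly (pderiv g) x = 0 \<Longrightarrow> x \<in> \<psi> ` C" using critg by auto
      show "\<And>c. c \<in> \<psi> ` C \<Longrightarrow> sgn (poly g c) = sgn (poly f (\<theta> c))" using sgC \<theta> by auto
      show "\<And>c. c \<in> \<psi> ` C \<Longrightarrow> -1 \<le> c \<and> c \<le> 1" using mem CI by auto
    qed (use y False in auto)
    then obtain r where r: "poly f r = 0" 
      and rl: "\<And>c. c \<in> C \<Longrightarrow> \<psi> c < y \<Longrightarrow> c < r" and ru: "\<And>c. c \<in> C \<Longrightarrow> y < \<psi> c \<Longrightarrow> r < c"
      using \<theta> by auto
    have r1: "-1 < r" using rl[OF C(3)] order_bij_ends[OF \<psi>] y False C(3) by (metis atLeastAtMost_iff image_eqI order_le_less)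
    have r2: "r < 1" using ru[OF C(4)] order_bij_ends[OF \<psi>] y False C(4) by (metis atLeastAtMost_iff image_eqI order_le_less)
    have "r \<notin> C" using rl[of r] ru[of r] False by (metis image_eqI linorder_neqE_linordered_idom order_less_irrefl)
    then have rR: "r \<in> R" using r r1 r2 by (auto simp: R_def)
    have "\<rho> r = y"
    proof (rule ccontr)
      assume "\<rho> r \<noteq> y"
      have \<rho>I: "\<rho> r \<in> {-1..1}" using \<rho>l[OF rR C(3) r1] \<rho>u[OF rR C(4) r2] order_bij_ends[OF \<psi>] by auto
      consider "\<rho> r < y" | "y < \<rho> r" using \<open>\<rho> r \<noteq> y\<close> by linarith
      then show False
      proof cases
        case 1
        obtain z where z: "\<rho> r < z" "z < y" "poly (pderiv g) z = 0"
          using rolle_poly[OF 1 \<rho>0[OF rR] y(2)] by blast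
        then obtain c where c: "c \<in> C" "z = \<psi> c" using critg[of z] \<rho>I y(1) by auto
        then have "c < r" using rl z by auto
        then show False using \<rho>l[OF rR c(1)] z c by auto
      next
        case 2
        obtain z where z: "y < z" "z < \<rho> r" "poly (pderiv g) z = 0"
          using rolle_poly[OF 2 y(2) \<rho>0[OF rR]] by blast
        then obtain c where c: "c \<in> C" "z = \<psi> c" using critg[of z] \<rho>I y(1) by auto
        then have "r < c" using ru z by auto
        then show False using \<rho>u[OF rR c(1)] z c by auto
      qed
    qed
    then have "\<psi>' r = y" using \<psi>'0(3)[of r] rR \<open>r \<notin> C\<close> by (simp add: D_def \<phi>_def)
    then show ?thesis using rR by (auto simp: D_def)
  qed
  have sI: "sgn (poly (p i) x) = sgn (poly (q i) (\<psi>' x))" if i: "i \<in> I" and x: "x \<in> {-1..1}" for i x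
    using rootsI[OF i]
  proof
    assume "degree (p i) = 0 \<and> degree (q i) = 0"
    then show ?thesis using sgI[OF i x] by (simp add: poly_of_degree_zero)
  next
    assume rt: "\<forall>x\<in>{-1..1}. poly (p i) x = 0 \<longrightarrow> x \<in> C"
    show ?thesis
    proof (cases "x \<in> C")
      case True
      then show ?thesis using sgI[OF i x] onC by simp
    next
      case False
      (* The point w, at which the old matching hits the new partner of x, lies in the same gap of C as x. *)
      obtain w where w: "w \<in> {-1..1}" "\<psi> w = \<psi>' x"
        using order_bij_surj[OF \<psi> order_bij_mem[OF \<psi>' x]] by blast
      have side: "c < x \<longleftrightarrow> c < w" "x < c \<longleftrightarrow> w < c" if "c \<in> C" for c
      proof -
        show "c < x \<longleftrightarrow> c < w" using less[of c w] less'[of c x] onC[OF that] CI[OF that] w by simp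
        show "x < c \<longleftrightarrow> w < c" using less[of w c] less'[of x c] onC[OF that] CI[OF that] w by simp
      qed
      have "sgn (poly (p i) x) = sgn (poly (p i) w)"
      proof (cases "x \<le> w")
        case True
        show ?thesis
        proof (rule sgn_poly_eq_if_no_root[OF True])
          fix z assume z: "x \<le> z" "z \<le> w"
          have "z \<notin> C" using z side[of z] False by (metis leD order_le_less)
          then show "poly (p i) z \<noteq> 0" using rt z x w(1) by auto
        qed
      next
        case wx: False
        show ?thesis
        proof (rule sgn_poly_eq_if_no_root[symmetric])
          fix z assume z: "w \<le> z" "z \<le> x"
          have "z \<notin> C" using z side[of z] False by (metis leD order_le_less)
          then show "poly (p i) z \<noteq> 0" using rt z x w(1) by auto
        qed (use wx in simp)
      qed
      then show ?thesis using sgI[OF i w(1)] w(2) by simp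
    qed
  qed
  have "sgn (poly f x) = sgn (poly g (\<psi>' x))" if x: "x \<in> {-1..1}" for x
  proof (cases "x \<in> D")
    case True
    show ?thesis
    proof (cases "x \<in> C")
      case True then show ?thesis using sgC onC by simp
    next
      case False
      then have "x \<in> R" using True by (simp add: D_def)
      then show ?thesis using \<psi>'0(3)[OF True] False RI(2) \<rho>0 by (simp add: \<phi>_def)
    qed
  next
    case False
    have D1: "-1 \<in> D" "1 \<in> D" using C(3,4) by (auto simp: D_def)
    obtain a b where ab: "a \<in> D" "b \<in> D" "a < x" "x < b" "\<And>c. c \<in> D \<Longrightarrow> c \<le> a \<or> b \<le> c"
      using finite_neighbours[OF finD D1 _ _ False] x by (metis atLeastAtMost_iff)
    have gapf: "z \<notin> D" if "a < z" "z \<le> x" for z using ab(5)[of z] that ab(4) by auto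
    have gapg: "z \<notin> \<psi>' ` D" if "\<psi>' a < z" "z \<le> \<psi>' x" for z
    proof
      assume "z \<in> \<psi>' ` D"
      then obtain c where "c \<in> D" "z = \<psi>' c" by blast
      then show False using that less' gapf[of c] by (metis linorder_not_less)
    qed
    have aI: "a \<in> {-1..1}" using ab(1) CI RI by (auto simp: D_def)
    have a'I: "\<psi>' a \<in> {-1..1}" "\<psi>' x \<in> {-1..1}" using order_bij_mem[OF \<psi>'] aI x by auto
    have lt': "\<psi>' a < \<psi>' x" using less' ab(3) by simp
    have fD: "z \<in> D" if "z \<in> {-1..1}" "poly f z = 0" for z using that by (auto simp: D_def R_def)
    have sa: "sgn (poly f a) = sgn (poly g (\<psi>' a))"
    proof (cases "a \<in> C")
      case True then show ?thesis using sgC onC by simp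
    next
      case False
      then have "a \<in> R" using ab by (simp add: D_def)
      then show ?thesis using \<psi>'0(3)[OF ab(1)] False RI(2) \<rho>0 by (simp add: \<phi>_def)
    qed
    show ?thesis
    proof (cases "poly f a = 0")
      case True
      then have ga: "poly g (\<psi>' a) = 0" using sa by (simp add: sgn_0_0)
      have "sgn (poly f x) = sgn (poly (pderiv f) x)"
      proof (rule sgn_poly_after_root[OF ab(3) True])
        show "poly (pderiv f) z \<noteq> 0" if "a < z" "z \<le> x" for z
          using gapf[OF that] that d(4)[of z] CD aI x by auto
      qed
      also have "\<dots> = sgn (poly (pderiv g) (\<psi>' x))" using sI[OF d(1) x] d(2,3) by simp
      also have "\<dots> = sgn (poly g (\<psi>' x))"
      proof (rule sgn_poly_after_root[OF lt' ga, symmetric])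
        show "poly (pderiv g) z \<noteq> 0" if "\<psi>' a < z" "z \<le> \<psi>' x" for z
          using gapg[OF that] that critg[of z] CD a'I by auto
      qed
      finally show ?thesis .
    next
      case False
      then have ga: "poly g (\<psi>' a) \<noteq> 0" using sa by (metis sgn_0_0)
      have "sgn (poly f a) = sgn (poly f x)"
      proof (rule sgn_poly_eq_if_no_root)
        show "poly f z \<noteq> 0" if "a \<le> z" "z \<le> x" for z
          using that False gapf[of z] fD[of z] aI x by (cases "z = a") auto
      qed (use ab in simp)
      moreover have "sgn (poly g (\<psi>' a)) = sgn (poly g (\<psi>' x))"
      proof (rule sgn_poly_eq_if_no_root)
        show "poly g z \<noteq> 0" if "\<psi>' a \<le> z" "z \<le> \<psi>' x" for z
          using that ga gapg[of z] rootsg[of z] a'I by (cases "z = \<psi>' a") auto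
      qed (use lt' in simp)
      ultimately show ?thesis using sa by simp
    qed
  qed
  then show ?thesis using \<psi>' sI by blast
qed

section \<open>Semialgebraic sets\<close>

lemmas rpf_linear = real_polynomial_function.intros(1)
  and rpf_const = real_polynomial_function.intros(2)
  and rpf_add = real_polynomial_function.intros(3)
  and rpf_mult = real_polynomial_function.intros(4)

lemma semialgebraic_nonzero: "real_polynomial_function f \<Longrightarrow> semialgebraic {x. f x \<noteq> 0}"
  using semialgebraic.compl[OF semialgebraic.zero] by (simp add: Collect_neg_eq)

lemma semialgebraic_neg: 
  assumes "real_polynomial_function f" shows "semialgebraic {x. f x < 0}"
  using semialgebraic.pos[OF real_polynomial_function_minus[OF assms]] by simp

lemma semialgebraic_UNIV: "semialgebraic UNIV"
  using semialgebraic.zero[OF rpf_const[of 0]] by simp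

lemma semialgebraic_empty: "semialgebraic {}"
  using semialgebraic.compl[OF semialgebraic_UNIV] by simp

lemma semialgebraic_Union:
  "finite \<A> \<Longrightarrow> (\<And>A. A \<in> \<A> \<Longrightarrow> semialgebraic A) \<Longrightarrow> semialgebraic (\<Union>\<A>)"
  by (induction rule: finite_induct) (auto intro: semialgebraic_empty semialgebraic.un)

lemma semialgebraic_Collect_ball:
  assumes "finite I" "\<And>i. i \<in> I \<Longrightarrow> semialgebraic {x. P i x}"
  shows "semialgebraic {x. \<forall>i\<in>I. P i x}"
  using assms
proof (induction rule: finite_induct)
  case empty then show ?case by (simp add: semialgebraic_UNIV)
next
  case (insert i I)
  have "{x. \<forall>j\<in>insert i I. P j x} = {x. P i x} \<inter> {x. \<forall>j\<in>I. P j x}" by auto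
  then show ?case using insert by (simp add: semialgebraic.inter)
qed

lemma semialgebraic_sgn:
  assumes "real_polynomial_function f" shows "semialgebraic {x. sgn (f x) = s}"
proof -
  consider "s = 0" | "s = 1" | "s = -1" | "s \<notin> {0,1,-1}" by blast
  then show ?thesis
  proof cases
    case 4
    then have "{x. sgn (f x) = s} = {}" by (auto simp: sgn_if)
    then show ?thesis by (simp add: semialgebraic_empty)
  qed (use semialgebraic.zero[OF assms] semialgebraic.pos[OF assms] semialgebraic_neg[OF assms]
       in \<open>auto simp: sgn_0_0 sgn_1_pos sgn_1_neg\<close>)
qed

section \<open>Polynomials with parameters\<close>

text \<open>
  A polynomial in one variable whose coefficients are polynomial functions of a parameter, given
  by its specialisations. The uniform degree bound makes it a polynomial over the ring of
  polynomial functions rather than a mere family.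
\<close>

definition param_poly :: "('a::euclidean_space \<Rightarrow> real poly) \<Rightarrow> bool" where
  "param_poly P \<longleftrightarrow> (\<exists>d. \<forall>y. degree (P y) \<le> d) \<and> (\<forall>k. real_polynomial_function (\<lambda>y. coeff (P y) k))"

lemma param_poly_const:
  assumes "real_polynomial_function f" shows "param_poly (\<lambda>y. [:f y:])"
proof -
  have "real_polynomial_function (\<lambda>y. coeff [:f y:] k)" for k
    using assms by (cases k) (simp_all add: rpf_const)
  then show ?thesis by (auto simp: param_poly_def)
qed

lemma param_poly_monom:
  assumes "real_polynomial_function f" shows "param_poly (\<lambda>y. monom (f y) n)"
proof -
  have "real_polynomial_function (\<lambda>y. coeff (monom (f y) n) k)" for k
    using assms by (cases "n = k") (simp_all add: rpf_const)
  then show ?thesis by (auto simp: param_poly_def intro: degree_monom_le)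
qed

lemma param_poly_add:
  assumes "param_poly P" "param_poly Q" shows "param_poly (\<lambda>y. P y + Q y)"
proof -
  obtain d e where "\<forall>y. degree (P y) \<le> d" "\<forall>y. degree (Q y) \<le> e"
    using assms by (auto simp: param_poly_def)
  then have "\<forall>y. degree (P y + Q y) \<le> max d e" by (meson degree_add_le max.coboundedI1 max.coboundedI2)
  then show ?thesis using assms by (auto simp: param_poly_def intro: rpf_add)
qed

lemma param_poly_mult:
  assumes "param_poly P" "param_poly Q" shows "param_poly (\<lambda>y. P y * Q y)"
proof -
  obtain d e where "\<forall>y. degree (P y) \<le> d" "\<forall>y. degree (Q y) \<le> e"
    using assms by (auto simp: param_poly_def)
  then have "\<forall>y. degree (P y * Q y) \<le> d + e" by (meson add_mono degree_mult_le order_trans)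
  then show ?thesis using assms unfolding param_poly_def coeff_mult
    by (auto intro!: real_polynomial_function_sum rpf_mult)
qed

lemma param_poly_smult:
  assumes "real_polynomial_function f" "param_poly P" shows "param_poly (\<lambda>y. smult (f y) (P y))"
  using param_poly_mult[OF param_poly_const[OF assms(1)] assms(2)] by simp

lemma param_poly_diff:
  assumes "param_poly P" "param_poly Q" shows "param_poly (\<lambda>y. P y - Q y)"
  using param_poly_add[OF assms(1) param_poly_smult[OF rpf_const[of "-1"] assms(2)]]
  by simp

lemma param_poly_pderiv:
  assumes "param_poly P" shows "param_poly (\<lambda>y. pderiv (P y))"
proof -
  obtain d where "\<forall>y. degree (P y) \<le> d" using assms by (auto simp: param_poly_def)
  then have "\<forall>y. degree (pderiv (P y)) \<le> d" by (metis degree_pderiv diff_le_self order_trans)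
  then show ?thesis using assms unfolding param_poly_def coeff_pderiv
    by (auto intro!: rpf_mult rpf_const)
qed

lemma param_poly_eval:
  assumes "param_poly P" shows "real_polynomial_function (\<lambda>y. poly (P y) c)"
proof -
  obtain d where d: "\<forall>y. degree (P y) \<le> d" using assms by (auto simp: param_poly_def)
  have "poly (P y) c = (\<Sum>k\<le>d. coeff (P y) k * c ^ k)" for y
    unfolding poly_altdef using d
    by (intro sum.mono_neutral_left) (auto simp: not_le coeff_eq_0)
  then show ?thesis using assms unfolding param_poly_def
    by (auto intro!: real_polynomial_function_sum rpf_mult rpf_const)
qed

text \<open>
  The degree as a polynomial over the ring of coefficient functions; specialising the parameter
  can make the degree drop.
\<close>

definition degree_bound :: "('a::euclidean_space \<Rightarrow> real poly) \<Rightarrow> nat" where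
  "degree_bound P = (LEAST d. \<forall>y. degree (P y) \<le> d)"

lemma degree_le_degree_bound: "param_poly P \<Longrightarrow> degree (P y) \<le> degree_bound P"
  unfolding degree_bound_def param_poly_def by (rule LeastI2_ex) auto

lemma degree_bound_less: "(\<And>y. degree (P y) < d) \<Longrightarrow> degree_bound P < d"
  unfolding degree_bound_def by (cases d) (auto intro!: Least_le simp: less_Suc_eq_le)

text \<open>
  Division by \<open>Q\<close> without inverting its leading coefficient \<open>c\<close>: each step multiplies by \<open>c\<^sup>2\<close> rather
  than by \<open>c\<close>, so that signs are preserved. At a root of \<open>Q\<close> the sign of \<open>P\<close> is thereby read off
  from a polynomial of smaller degree than \<open>Q\<close>.
\<close>

lemma pseudo_remainder:
  assumes "param_poly P" "param_poly Q" "\<And>y. degree (Q y) \<le> e" "e > 0"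
  shows "\<exists>R. param_poly R \<and> (\<forall>y. degree (R y) < e) \<and>
    (\<forall>y x. coeff (Q y) e \<noteq> 0 \<longrightarrow> poly (Q y) x = 0 \<longrightarrow> sgn (poly (P y) x) = sgn (poly (R y) x))"
proof -
  have "\<exists>R. param_poly R \<and> (\<forall>y. degree (R y) < e) \<and>
    (\<forall>y x. coeff (Q y) e \<noteq> 0 \<longrightarrow> poly (Q y) x = 0 \<longrightarrow> sgn (poly (P y) x) = sgn (poly (R y) x))"
    if "param_poly P" "\<And>y. degree (P y) \<le> n" for n P
    using that
  proof (induction n arbitrary: P)
    case 0
    then show ?case using assms(4) by (intro exI[of _ P]) auto
  next
    case (Suc n)
    show ?case
    proof (cases "Suc n < e")
      case True
      then show ?thesis using Suc.prems le_less_trans by (intro exI[of _ P]) blast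
    next
      case False
      define c where "c = (\<lambda>y. coeff (Q y) e)"
      define a where "a = (\<lambda>y. coeff (P y) (Suc n))"
      define P1 where "P1 = (\<lambda>y. smult (c y * c y) (P y) - monom (c y * a y) (Suc n - e) * Q y)"
      have ca: "real_polynomial_function c" "real_polynomial_function a"
        using assms(2) Suc.prems(1) by (auto simp: c_def a_def param_poly_def)
      have P1: "param_poly P1" unfolding P1_def
        using Suc.prems(1) assms(2) ca
        by (intro param_poly_diff param_poly_smult param_poly_mult param_poly_monom rpf_mult)
      have "degree (P1 y) \<le> n" for y
      proof (rule degree_le, intro allI impI)
        fix i assume i: "n < i"
        show "coeff (P1 y) i = 0"
        proof (cases "i = Suc n")
          case True
          then show ?thesis using False by (simp add: P1_def coeff_monom_mult a_def c_def)
        next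
          case ne: False
          then have "coeff (P y) i = 0" using i Suc.prems(2)[of y] by (intro coeff_eq_0) linarith
          moreover have "coeff (Q y) (i - (Suc n - e)) = 0"
            using i ne False assms(3)[of y] by (intro coeff_eq_0) linarith
          ultimately show ?thesis by (simp add: P1_def coeff_monom_mult)
        qed
      qed
      then obtain R where R: "param_poly R" "\<And>y. degree (R y) < e"
        "\<And>y x. coeff (Q y) e \<noteq> 0 \<Longrightarrow> poly (Q y) x = 0 \<Longrightarrow> sgn (poly (P1 y) x) = sgn (poly (R y) x)"
        using Suc.IH[OF P1] by blast
      have "sgn (poly (P y) x) = sgn (poly (P1 y) x)" if "coeff (Q y) e \<noteq> 0" "poly (Q y) x = 0" for y x
        using that by (cases "coeff (Q y) e > 0") (simp_all add: P1_def c_def sgn_mult)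
      then show ?thesis using R by auto
    qed
  qed
  then show ?thesis using assms(1) unfolding param_poly_def by blast
qed

section \<open>Finitely many semialgebraic sign types\<close>

text \<open>
  Two parameter values are equivalent if the specialised families run through the same sign
  patterns, in the same order, as the variable traverses \<open>[-1,1]\<close>. Whether a given system of sign
  conditions has a solution in \<open>[-1,1]\<close> depends only on the equivalence class.
\<close>

definition sign_equiv :: "('a::euclidean_space \<Rightarrow> real poly) set \<Rightarrow> 'a \<Rightarrow> 'a \<Rightarrow> bool" where
  "sign_equiv F y z \<longleftrightarrow> (\<exists>\<psi>. order_bij \<psi> \<and>
     (\<forall>P\<in>F. \<forall>x\<in>{-1..1}. sgn (poly (P y) x) = sgn (poly (P z) (\<psi> x))))"

text \<open>
  The pieces need not be whole equivalence classes and may overlap. This makes the notion stable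
  under finite unions and under replacing \<open>F\<close> by a family with a coarser equivalence.
\<close>

definition tame :: "('a::euclidean_space \<Rightarrow> real poly) set \<Rightarrow> 'a set \<Rightarrow> bool" where
  "tame F Z \<longleftrightarrow> (\<exists>\<A>. finite \<A> \<and> \<Union>\<A> = Z \<and>
     (\<forall>A\<in>\<A>. semialgebraic A \<and> (\<forall>y\<in>A. \<forall>z\<in>A. sign_equiv F y z)))"

lemma tame_Un: 
  assumes "tame F Z" "tame F W" shows "tame F (Z \<union> W)"
proof -
  obtain \<A> \<B> where "finite \<A>" "\<Union>\<A> = Z" "\<forall>A\<in>\<A>. semialgebraic A \<and> (\<forall>y\<in>A. \<forall>z\<in>A. sign_equiv F y z)"
    "finite \<B>" "\<Union>\<B> = W" "\<forall>A\<in>\<B>. semialgebraic A \<and> (\<forall>y\<in>A. \<forall>z\<in>A. sign_equiv F y z)"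
    using assms unfolding tame_def by metis
  then show ?thesis unfolding tame_def by (intro exI[of _ "\<A> \<union> \<B>"]) auto
qed

lemma tame_UN:
  assumes "finite I" "\<And>i. i \<in> I \<Longrightarrow> tame F (Z i)" shows "tame F (\<Union>i\<in>I. Z i)"
  using assms
proof (induction rule: finite_induct)
  case empty
  show ?case unfolding tame_def by (intro exI[of _ "{}"]) auto
qed (simp add: tame_Un)

lemma tame_transfer:
  assumes "tame F Z" "\<And>y z. y \<in> Z \<Longrightarrow> z \<in> Z \<Longrightarrow> sign_equiv F y z \<Longrightarrow> sign_equiv G y z"
  shows "tame G Z"
proof -
  obtain \<A> where "finite \<A>" "\<Union>\<A> = Z" "\<forall>A\<in>\<A>. semialgebraic A \<and> (\<forall>y\<in>A. \<forall>z\<in>A. sign_equiv F y z)"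
    using assms(1) unfolding tame_def by metis
  then show ?thesis unfolding tame_def using assms(2) by (intro exI[of _ \<A>]) blast
qed

lemma order_bij_id: "order_bij (\<lambda>x. x)"
  by (auto simp: order_bij_def strict_mono_on_def)

lemma tame_constants:
  fixes F :: "('a::euclidean_space \<Rightarrow> real poly) set"
  assumes "finite F" "\<And>P. P \<in> F \<Longrightarrow> param_poly P" "\<And>P y. P \<in> F \<Longrightarrow> degree (P y) = 0" "semialgebraic Z"
  shows "tame F Z"
proof -
  define cell where "cell = (\<lambda>\<sigma>::('a \<Rightarrow> real poly) \<Rightarrow> real. Z \<inter> {y. \<forall>P\<in>F. sgn (coeff (P y) 0) = \<sigma> P})"
  define \<A> where "\<A> = cell ` (F \<rightarrow>\<^sub>E {-1,0,1})"
  have "finite \<A>" unfolding \<A>_def using assms(1) by (intro finite_imageI finite_PiE) auto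
  moreover have "\<Union>\<A> = Z"
  proof
    show "Z \<subseteq> \<Union>\<A>"
    proof
      fix y assume "y \<in> Z"
      then have "y \<in> cell (restrict (\<lambda>P. sgn (coeff (P y) 0)) F)" by (auto simp: cell_def)
      moreover have "restrict (\<lambda>P. sgn (coeff (P y) 0)) F \<in> F \<rightarrow>\<^sub>E {-1,0,1}" by (auto simp: sgn_if)
      ultimately show "y \<in> \<Union>\<A>" unfolding \<A>_def by blast
    qed
  qed (auto simp: \<A>_def cell_def)
  moreover have "semialgebraic A" if "A \<in> \<A>" for A
    using that assms unfolding \<A>_def cell_def
    by (auto intro!: semialgebraic.inter semialgebraic_Collect_ball semialgebraic_sgn simp: param_poly_def)
  moreover have "sign_equiv F y z" if A: "A \<in> \<A>" "y \<in> A" "z \<in> A" for A y z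
    unfolding sign_equiv_def
  proof (intro exI conjI ballI)
    show "order_bij (\<lambda>x. x)" by (rule order_bij_id)
    fix P x assume "P \<in> F"
    then show "sgn (poly (P y) x) = sgn (poly (P z) x)"
      using A assms(3) by (auto simp: \<A>_def cell_def poly_of_degree_zero)
  qed
  ultimately show ?thesis unfolding tame_def by blast
qed

lemma mult_degree_bound_decrease:
  assumes "finite F" "P \<in> F" "finite G" "\<And>Q. Q \<in> G \<Longrightarrow> degree_bound Q < degree_bound P"
  shows "(image_mset degree_bound (mset_set ((F - {P}) \<union> G)), image_mset degree_bound (mset_set F)) \<in> mult less_than"
proof -
  define K where "K = G - (F - {P})"
  have "(F - {P}) \<union> G = (F - {P}) \<union> K" "(F - {P}) \<inter> K = {}" "finite K" using assms by (auto simp: K_def)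
  then have 1: "mset_set ((F - {P}) \<union> G) = mset_set (F - {P}) + mset_set K"
    using assms(1) by (simp add: mset_set_Union)
  have 2: "mset_set F = mset_set (F - {P}) + {#P#}"
    using assms(1,2) by (metis add_mset_add_single finite_Diff insert_Diff insert_Diff_single mset_set.insert_remove)
  show ?thesis unfolding 1 2 image_mset_union
    using assms(3,4) by (intro one_step_implies_mult) (auto simp: K_def)
qed

text \<open>
  Hormander's reduction: when no leading coefficient vanishes at \<open>y\<close> and \<open>z\<close>, the sign pattern of a
  family is determined by that of the family in which a member \<open>P\<close> of positive degree is replaced by
  its derivative, its values at the two ends of the interval, and its remainders modulo the other
  members and modulo its derivative: at a root of \<open>Q\<close>, the sign of \<open>P\<close> is that of its remainder modulo
  \<open>Q\<close>. A member of degree bound \<open>0\<close> is constant in the variable and contributes no marked points.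
\<close>

lemma sign_equiv_add_polynomial:
  fixes F :: "('a::euclidean_space \<Rightarrow> real poly) set"
  assumes F: "finite F" "P \<notin> F"
    and par: "\<And>Q. Q \<in> F \<Longrightarrow> param_poly Q" "param_poly P" "0 < degree_bound P"
    and lc: "\<And>Q. Q \<in> insert P F \<Longrightarrow> 0 < degree_bound Q \<Longrightarrow> coeff (Q y) (degree_bound Q) \<noteq> 0 \<and> coeff (Q z) (degree_bound Q) \<noteq> 0"
    and R: "\<And>Q. Q \<in> F \<Longrightarrow> 0 < degree_bound Q \<Longrightarrow> R Q \<in> G \<and> 
        (\<forall>w x. coeff (Q w) (degree_bound Q) \<noteq> 0 \<longrightarrow> poly (Q w) x = 0 \<longrightarrow> sgn (poly (P w) x) = sgn (poly (R Q w) x))"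
    and R': "1 < degree_bound P \<Longrightarrow> R' \<in> G \<and> 
        (\<forall>w x. coeff (P w) (degree_bound P) \<noteq> 0 \<longrightarrow> poly (pderiv (P w)) x = 0 \<longrightarrow> sgn (poly (P w) x) = sgn (poly (R' w) x))"
    and G: "(\<lambda>w. pderiv (P w)) \<in> G" "(\<lambda>w. [:poly (P w) (-1):]) \<in> G" "(\<lambda>w. [:poly (P w) 1:]) \<in> G"
    and eq: "sign_equiv (F \<union> G) y z"
  shows "sign_equiv (insert P F) y z"
proof -
  obtain \<psi> where \<psi>: "order_bij \<psi>"
    and sg: "\<And>Q x. Q \<in> F \<union> G \<Longrightarrow> x \<in> {-1..1} \<Longrightarrow> sgn (poly (Q y) x) = sgn (poly (Q z) (\<psi> x))"
    using eq unfolding sign_equiv_def by blast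
  define N where "N = {Q\<in>F. 0 < degree_bound Q}"
  define dP where "dP = (\<lambda>w. pderiv (P w))"
  define C where "C = {-1,1} \<union> (\<Union>Q\<in>insert dP N. {x\<in>{-1..1}. poly (Q y) x = 0})"
  have lcP: "coeff (P y) (degree_bound P) \<noteq> 0" "coeff (P z) (degree_bound P) \<noteq> 0" using lc par(3) by auto
  have dPne: "pderiv (P y) \<noteq> 0"
    using lcP(1) par(3) le_degree[of "P y" "degree_bound P"] by (simp add: pderiv_eq_0_iff)
  have ne: "Q y \<noteq> 0" if "Q \<in> insert dP N" for Q
    using that dPne lc[of Q] by (auto simp: dP_def N_def)
  have finC: "finite C" unfolding C_def
    using F(1) ne by (auto simp: N_def intro!: finite_subset[OF _ poly_roots_finite])
  have ends: "\<psi> (-1) = -1" "\<psi> 1 = 1" using order_bij_ends[OF \<psi>] by auto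
  have "\<exists>\<psi>'. order_bij \<psi>' \<and> (\<forall>x\<in>{-1..1}. (\<forall>Q\<in>insert dP F. sgn (poly (Q y) x) = sgn (poly (Q z) (\<psi>' x)))
      \<and> sgn (poly (P y) x) = sgn (poly (P z) (\<psi>' x)))"
  proof (rule add_polynomial_to_matching[OF \<psi> _ finC, where d = dP])
    show "sgn (poly (Q y) x) = sgn (poly (Q z) (\<psi> x))" if "Q \<in> insert dP F" "x \<in> {-1..1}" for Q x
      using that sg G(1) by (auto simp: dP_def)
    show "C \<subseteq> {-1..1}" "-1 \<in> C" "1 \<in> C" by (auto simp: C_def)
    show "(\<forall>x\<in>{-1..1}. poly (Q y) x = 0 \<longrightarrow> x \<in> C) \<or> (degree (Q y) = 0 \<and> degree (Q z) = 0)"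
      if "Q \<in> insert dP F" for Q
    proof (cases "Q \<in> insert dP N")
      case True then show ?thesis by (auto simp: C_def)
    next
      case False
      then have "Q \<in> F" "degree_bound Q = 0" using that by (auto simp: N_def)
      then show ?thesis using degree_le_degree_bound[OF par(1)[of Q]] by (metis le_zero_eq)
    qed
    show "dP \<in> insert dP F" "dP y = pderiv (P y)" "dP z = pderiv (P z)" by (auto simp: dP_def)
    show "x \<in> C" if "x \<in> {-1..1}" "poly (pderiv (P y)) x = 0" for x
      using that by (auto simp: C_def dP_def)
    show "P y \<noteq> 0" using dPne by auto
    show "sgn (poly (P y) c) = sgn (poly (P z) (\<psi> c))" if c: "c \<in> C" for c
    proof -
      consider "c = -1" | "c = 1" | Q where "c \<in> {-1..1}" "Q \<in> N" "poly (Q y) c = 0" 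
        | "c \<in> {-1..1}" "poly (dP y) c = 0"
        using c unfolding C_def by blast
      then show ?thesis
      proof cases
        case 1 then show ?thesis using sg[of "\<lambda>w. [:poly (P w) (-1):]" c] G(2) ends by simp
      next
        case 2 then show ?thesis using sg[of "\<lambda>w. [:poly (P w) 1:]" c] G(3) ends by simp
      next
        case (3 Q)
        then have Q: "Q \<in> F" "0 < degree_bound Q" by (auto simp: N_def)
        have "poly (Q z) (\<psi> c) = 0" using sg[of Q c] Q 3 by (simp add: sgn_0_0)
        then have "sgn (poly (P y) c) = sgn (poly (R Q y) c)" 
          "sgn (poly (P z) (\<psi> c)) = sgn (poly (R Q z) (\<psi> c))"
          using R[OF Q] lc[of Q] Q 3 by auto
        then show ?thesis using sg[of "R Q" c] R[OF Q] 3(1) by auto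
      next
        case 4
        (* If P has degree 1, its derivative is a nonzero constant and has no roots. *)
        have "1 < degree_bound P"
        proof (rule ccontr)
          assume "\<not> 1 < degree_bound P"
          then have "degree_bound P = 1" using par(3) by simp
          then have "degree (P y) \<le> 1" using degree_le_degree_bound[OF par(2), of y] by simp
          then have "degree (dP y) = 0" by (simp add: dP_def degree_pderiv)
          moreover from this have "coeff (dP y) 0 = 0" using 4(2) by (simp add: poly_of_degree_zero)
          ultimately show False using dPne by (metis dP_def leading_coeff_0_iff)
        qed
        note R'1 = R'[OF this]
        have "poly (dP z) (\<psi> c) = 0" using sg[of dP c] G(1) 4 by (simp add: sgn_0_0 dP_def)
        then have "sgn (poly (P y) c) = sgn (poly (R' y) c)" 
          "sgn (poly (P z) (\<psi> c)) = sgn (poly (R' z) (\<psi> c))"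
          using R'1 lcP 4 by (auto simp: dP_def)
        then show ?thesis using sg[of R' c] R'1 4(1) by auto
      qed
    qed
  qed
  then show ?thesis unfolding sign_equiv_def by blast
qed

text \<open>
  By induction on the multiset of degree bounds. Where the leading coefficient of a nonconstant
  member vanishes, that member can be truncated. Where none vanishes, a member of maximal degree is
  replaced as in \<open>sign_equiv_add_polynomial\<close>; all its replacements have smaller degree. When only
  constants are left, the sign types are cut out by the signs of the coefficients.
\<close>

theorem finite_semialgebraic_sign_types:
  fixes F :: "('a::euclidean_space \<Rightarrow> real poly) set"
  assumes "finite F" "\<And>P. P \<in> F \<Longrightarrow> param_poly P" "semialgebraic Z"
  shows "tame F Z"
  using assms
proof (induction F arbitrary: Z rule: wf_induct_rule[OF wf_inv_image[OF wf_mult[OF wf_less_than], of "\<lambda>F. image_mset degree_bound (mset_set F)"]])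
  case (1 F)
  note fin = "1.prems"(1) and par = "1.prems"(2) and Z = "1.prems"(3)
  have IH: "tame ((F - {P}) \<union> G) W"
    if "P \<in> F" "finite G" "\<And>Q. Q \<in> G \<Longrightarrow> param_poly Q \<and> degree_bound Q < degree_bound P" "semialgebraic W" for P G W
    using that fin par by (intro "1.IH") (auto simp del: mset_set_Union intro!: mult_degree_bound_decrease)
  define N where "N = {P\<in>F. 0 < degree_bound P}"
  have finN: "finite N" using fin by (simp add: N_def)
  have lcpoly: "real_polynomial_function (\<lambda>y. coeff (P y) (degree_bound P))" if "P \<in> F" for P
    using par[OF that] by (simp add: param_poly_def)
  define Z0 where "Z0 = Z \<inter> {y. \<forall>P\<in>N. coeff (P y) (degree_bound P) \<noteq> 0}"
  have Z0: "semialgebraic Z0" unfolding Z0_def using Z finN lcpoly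
    by (intro semialgebraic.inter semialgebraic_Collect_ball semialgebraic_nonzero) (auto simp: N_def)
  have "tame F Z0"
  proof (cases "N = {}")
    case True
    have "degree (P y) = 0" if "P \<in> F" for P y
      using degree_le_degree_bound[OF par[OF that], of y] that True by (simp add: N_def)
    then show ?thesis using tame_constants fin par Z0 by blast
  next
    case False
    then have "Max (degree_bound ` N) \<in> degree_bound ` N" using finN by (intro Max_in) auto
    then obtain P where P: "P \<in> N" and "degree_bound P = Max (degree_bound ` N)" by auto
    then have Pmax: "degree_bound Q \<le> degree_bound P" if "Q \<in> N" for Q using finN that by auto
    have PF: "P \<in> F" "0 < degree_bound P" "param_poly P" using P par by (auto simp: N_def)
    have "\<exists>R. param_poly R \<and> (\<forall>y. degree (R y) < degree_bound Q) \<and>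
        (\<forall>w x. coeff (Q w) (degree_bound Q) \<noteq> 0 \<longrightarrow> poly (Q w) x = 0 \<longrightarrow> sgn (poly (P w) x) = sgn (poly (R w) x))"
      if "Q \<in> N" for Q
      using that par degree_le_degree_bound by (intro pseudo_remainder[OF PF(3)]) (auto simp: N_def)
    then obtain R where R: "\<And>Q. Q \<in> N \<Longrightarrow> param_poly (R Q)" "\<And>Q y. Q \<in> N \<Longrightarrow> degree (R Q y) < degree_bound Q"
      "\<And>Q w x. Q \<in> N \<Longrightarrow> coeff (Q w) (degree_bound Q) \<noteq> 0 \<Longrightarrow> poly (Q w) x = 0 \<Longrightarrow> sgn (poly (P w) x) = sgn (poly (R Q w) x)"
      by metis
    have dPpar: "param_poly (\<lambda>w. pderiv (P w))" using PF by (simp add: param_poly_pderiv)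
    have dPdeg: "degree (pderiv (P w)) \<le> degree_bound P - 1" for w
      using degree_le_degree_bound[OF PF(3), of w] by (simp add: degree_pderiv)
    have dPlt: "degree (pderiv (P w)) < degree_bound P" for w using dPdeg[of w] PF(2) by linarith
    have "\<exists>R'. param_poly R' \<and> (\<forall>y. degree (R' y) < degree_bound P) \<and> (1 < degree_bound P \<longrightarrow> 
        (\<forall>w x. coeff (P w) (degree_bound P) \<noteq> 0 \<longrightarrow> poly (pderiv (P w)) x = 0 \<longrightarrow> sgn (poly (P w) x) = sgn (poly (R' w) x)))"
    proof (cases "1 < degree_bound P")
      case True
      have "coeff (pderiv (P w)) (degree_bound P - 1) \<noteq> 0" if "coeff (P w) (degree_bound P) \<noteq> 0" for w
        using that PF(2) by (simp add: coeff_pderiv)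
      moreover obtain R' where "param_poly R'" "\<forall>y. degree (R' y) < degree_bound P - 1"
        "\<forall>w x. coeff (pderiv (P w)) (degree_bound P - 1) \<noteq> 0 \<longrightarrow> poly (pderiv (P w)) x = 0 \<longrightarrow> sgn (poly (P w) x) = sgn (poly (R' w) x)"
        using pseudo_remainder[OF PF(3) dPpar dPdeg] True by auto
      ultimately show ?thesis by (metis less_imp_diff_less order_less_trans PF(2) diff_less zero_less_one)
    next
      case False
      then show ?thesis using dPpar dPlt by (intro exI[of _ "\<lambda>w. pderiv (P w)"]) simp
    qed
    then obtain R' where R': "param_poly R'" "\<And>y. degree (R' y) < degree_bound P"
      "1 < degree_bound P \<Longrightarrow> (\<forall>w x. coeff (P w) (degree_bound P) \<noteq> 0 \<longrightarrow> poly (pderiv (P w)) x = 0 \<longrightarrow> sgn (poly (P w) x) = sgn (poly (R' w) x))"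
      by blast
    define G where "G = {\<lambda>w. pderiv (P w), \<lambda>w. [:poly (P w) (-1):], \<lambda>w. [:poly (P w) 1:], R'} \<union> R ` (N - {P})"
    have "tame ((F - {P}) \<union> G) Z0"
    proof (rule IH[OF PF(1) _ _ Z0])
      show "finite G" using finN by (simp add: G_def)
      fix Q assume "Q \<in> G"
      then have "param_poly Q \<and> (\<forall>w. degree (Q w) < degree_bound P)"
        unfolding G_def
      proof (elim UnE insertE emptyE imageE)
        fix Q' assume "Q = R Q'" "Q' \<in> N - {P}"
        then show ?thesis using R(1,2)[of Q'] Pmax[of Q'] by (auto intro: order.strict_trans2)
      qed (use dPpar dPlt PF R' in \<open>auto intro!: param_poly_const param_poly_eval\<close>)
      then show "param_poly Q \<and> degree_bound Q < degree_bound P" by (blast intro: degree_bound_less)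
    qed
    then show ?thesis
    proof (rule tame_transfer)
      fix y z assume yz: "y \<in> Z0" "z \<in> Z0" and eq: "sign_equiv ((F - {P}) \<union> G) y z"
      have "sign_equiv (insert P (F - {P})) y z"
      proof (rule sign_equiv_add_polynomial[where R = R and R' = R', OF _ _ _ PF(3,2) _ _ _ _ _ _ eq])
        show "coeff (Q y) (degree_bound Q) \<noteq> 0 \<and> coeff (Q z) (degree_bound Q) \<noteq> 0"
          if "Q \<in> insert P (F - {P})" "0 < degree_bound Q" for Q
          using that yz PF(1) by (auto simp: Z0_def N_def)
        show "R Q \<in> G \<and> (\<forall>w x. coeff (Q w) (degree_bound Q) \<noteq> 0 \<longrightarrow> poly (Q w) x = 0 \<longrightarrow> sgn (poly (P w) x) = sgn (poly (R Q w) x))"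
          if "Q \<in> F - {P}" "0 < degree_bound Q" for Q
          using that R(3)[of Q] by (auto simp: G_def N_def)
      qed (use fin par R'(3) in \<open>auto simp: G_def\<close>)
      then show "sign_equiv F y z" using PF(1) by (simp add: insert_absorb)
    qed
  qed
  moreover have "tame F (Z \<inter> {y. coeff (P y) (degree_bound P) = 0})" if P: "P \<in> N" for P
  proof -
    define T where "T = (\<lambda>y. P y - monom (coeff (P y) (degree_bound P)) (degree_bound P))"
    have PF: "P \<in> F" "0 < degree_bound P" "param_poly P" using P par by (auto simp: N_def)
    have T: "param_poly T" unfolding T_def
      using PF lcpoly by (intro param_poly_diff param_poly_monom) auto
    have "degree (T y) < degree_bound P" for y
    proof -
      have "degree (T y) \<le> degree_bound P - 1"
      proof (rule degree_le, intro allI impI)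
        fix i assume "degree_bound P - 1 < i"
        then show "coeff (T y) i = 0"
          using degree_le_degree_bound[OF PF(3), of y] by (cases "i = degree_bound P") (auto simp: T_def coeff_eq_0)
      qed
      then show ?thesis using PF(2) by linarith
    qed
    then have "degree_bound T < degree_bound P" by (rule degree_bound_less)
    then have "tame ((F - {P}) \<union> {T}) (Z \<inter> {y. coeff (P y) (degree_bound P) = 0})"
      using PF T Z semialgebraic.zero[OF lcpoly[OF PF(1)]]
      by (intro IH) (auto intro: semialgebraic.inter)
    then show ?thesis
    proof (rule tame_transfer)
      fix y z assume "y \<in> Z \<inter> {y. coeff (P y) (degree_bound P) = 0}" "z \<in> Z \<inter> {y. coeff (P y) (degree_bound P) = 0}"
      then have "T y = P y" "T z = P z" by (auto simp: T_def)
      then show "sign_equiv ((F - {P}) \<union> {T}) y z \<Longrightarrow> sign_equiv F y z"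
        unfolding sign_equiv_def by (metis Diff_iff UnCI empty_iff insertCI insertE)
    qed
  qed
  ultimately have "tame F (Z0 \<union> (\<Union>P\<in>N. Z \<inter> {y. coeff (P y) (degree_bound P) = 0}))"
    using finN by (intro tame_Un tame_UN)
  moreover have "Z0 \<union> (\<Union>P\<in>N. Z \<inter> {y. coeff (P y) (degree_bound P) = 0}) = Z" by (auto simp: Z0_def)
  ultimately show ?case by simp
qed

section \<open>Projections and polynomial images\<close>

lemma real_polynomial_along_line:
  fixes f :: "'a::euclidean_space \<Rightarrow> real"
  assumes "real_polynomial_function f"
  shows "\<exists>P. param_poly P \<and> (\<forall>y t. poly (P y) t = f (y + t *\<^sub>R b))"
  using assms
proof (induction rule: real_polynomial_function.induct)
  case (linear f)
  have "param_poly (\<lambda>y. [:f y:] + monom (f b) 1)"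
    using linear by (intro param_poly_add param_poly_const param_poly_monom rpf_linear rpf_const)
  moreover have "poly ([:f y:] + monom (f b) 1) t = f (y + t *\<^sub>R b)" for y t
    using bounded_linear.linear[OF linear] by (simp add: linear_add linear_scale poly_monom)
  ultimately show ?case by blast
next
  case (const c)
  have "param_poly (\<lambda>y. [:c:])" by (intro param_poly_const rpf_const)
  then show ?case by (intro exI[of _ "\<lambda>y. [:c:]"]) simp
next
  case (add f g)
  then obtain P Q where "param_poly P" "\<forall>y t. poly (P y) t = f (y + t *\<^sub>R b)"
    "param_poly Q" "\<forall>y t. poly (Q y) t = g (y + t *\<^sub>R b)" by blast
  then show ?case by (intro exI[of _ "\<lambda>y. P y + Q y"]) (simp add: param_poly_add)
next
  case (mult f g)
  then obtain P Q where "param_poly P" "\<forall>y t. poly (P y) t = f (y + t *\<^sub>R b)"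
    "param_poly Q" "\<forall>y t. poly (Q y) t = g (y + t *\<^sub>R b)" by blast
  then show ?case by (intro exI[of _ "\<lambda>y. P y * Q y"]) (simp add: param_poly_mult)
qed

text \<open>
  Every semialgebraic set is a union of sign cells of one finite family of polynomials. In this form
  projections can be treated without normal forms of Boolean combinations.
\<close>

lemma semialgebraic_determined_by_signs:
  assumes "semialgebraic A"
  shows "\<exists>F. finite F \<and> (\<forall>f\<in>F. real_polynomial_function f) \<and>
    (\<forall>x y. (\<forall>f\<in>F. sgn (f x) = sgn (f y)) \<longrightarrow> (x \<in> A \<longleftrightarrow> y \<in> A))"
  using assms
proof (induction rule: semialgebraic.induct)
  case (zero f)
  have "f x = 0 \<longleftrightarrow> f y = 0" if "sgn (f x) = sgn (f y)" for x y
    using that by (simp add: sgn_if split: if_splits)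
  with zero show ?case by (intro exI[of _ "{f}"]) blast
next
  case (pos f)
  have "f x > 0 \<longleftrightarrow> f y > 0" if "sgn (f x) = sgn (f y)" for x y
    using that by (simp add: sgn_if split: if_splits)
  with pos show ?case by (intro exI[of _ "{f}"]) blast
next
  case (compl A)
  then show ?case by (simp only: Compl_iff) blast
next
  case (un A B)
  obtain F where F: "finite F" "\<forall>f\<in>F. real_polynomial_function f"
    "\<forall>x y. (\<forall>f\<in>F. sgn (f x) = sgn (f y)) \<longrightarrow> (x \<in> A \<longleftrightarrow> y \<in> A)"
    using un.IH(1) by blast
  obtain G where G: "finite G" "\<forall>f\<in>G. real_polynomial_function f"
    "\<forall>x y. (\<forall>f\<in>G. sgn (f x) = sgn (f y)) \<longrightarrow> (x \<in> B \<longleftrightarrow> y \<in> B)"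
    using un.IH(2) by blast
  show ?case using F G by (intro exI[of _ "F \<union> G"] conjI finite_UnI) blast+
next
  case (inter A B)
  obtain F where F: "finite F" "\<forall>f\<in>F. real_polynomial_function f"
    "\<forall>x y. (\<forall>f\<in>F. sgn (f x) = sgn (f y)) \<longrightarrow> (x \<in> A \<longleftrightarrow> y \<in> A)"
    using inter.IH(1) by blast
  obtain G where G: "finite G" "\<forall>f\<in>G. real_polynomial_function f"
    "\<forall>x y. (\<forall>f\<in>G. sgn (f x) = sgn (f y)) \<longrightarrow> (x \<in> B \<longleftrightarrow> y \<in> B)"
    using inter.IH(2) by blast
  show ?case using F G by (intro exI[of _ "F \<union> G"] conjI finite_UnI) blast+
qed

text \<open>
  The Tarski-Seidenberg theorem for a bounded fibre: along the segment of direction \<open>b\<close> through \<open>y\<close>,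
  the polynomials that describe \<open>A\<close> become polynomials in one variable with parameter \<open>y\<close>, and
  whether the segment meets \<open>A\<close> depends only on the sign type of \<open>y\<close>. Moving along a direction inside
  the space, rather than dropping a coordinate, keeps the type fixed when projections are iterated.
\<close>

theorem semialgebraic_segment_projection:
  fixes A :: "'a::euclidean_space set"
  assumes "semialgebraic A"
  shows "semialgebraic {y. \<exists>t\<in>{-1..1}. y + t *\<^sub>R b \<in> A}"
proof -
  obtain F where F: "finite F" "\<And>f. f \<in> F \<Longrightarrow> real_polynomial_function f"
    and det: "\<And>x y. (\<And>f. f \<in> F \<Longrightarrow> sgn (f x) = sgn (f y)) \<Longrightarrow> (x \<in> A \<longleftrightarrow> y \<in> A)"
    using semialgebraic_determined_by_signs[OF assms] by metis
  have "\<exists>P. param_poly P \<and> (\<forall>y t. poly (P y) t = f (y + t *\<^sub>R b))" if "f \<in> F" for f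
    using real_polynomial_along_line F(2)[OF that] by blast
  then obtain P where P: "\<And>f. f \<in> F \<Longrightarrow> param_poly (P f)"
    "\<And>f y t. f \<in> F \<Longrightarrow> poly (P f y) t = f (y + t *\<^sub>R b)" by metis
  have "tame (P ` F) UNIV"
    using F P by (intro finite_semialgebraic_sign_types semialgebraic_UNIV) auto
  then obtain \<A> where \<A>: "finite \<A>" "\<Union>\<A> = UNIV" "\<And>B. B \<in> \<A> \<Longrightarrow> semialgebraic B"
    "\<And>B y z. B \<in> \<A> \<Longrightarrow> y \<in> B \<Longrightarrow> z \<in> B \<Longrightarrow> sign_equiv (P ` F) y z"
    unfolding tame_def by metis
  define E where "E = {y. \<exists>t\<in>{-1..1}. y + t *\<^sub>R b \<in> A}"
  have sat: "z \<in> E" if B: "B \<in> \<A>" "y \<in> B" "z \<in> B" and "y \<in> E" for B y z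
  proof -
    obtain t where t: "t \<in> {-1..1}" "y + t *\<^sub>R b \<in> A" using \<open>y \<in> E\<close> by (auto simp: E_def)
    obtain \<psi> where \<psi>: "order_bij \<psi>"
      "\<And>f x. f \<in> F \<Longrightarrow> x \<in> {-1..1} \<Longrightarrow> sgn (poly (P f y) x) = sgn (poly (P f z) (\<psi> x))"
      using \<A>(4)[OF B] unfolding sign_equiv_def by blast
    have "sgn (f (y + t *\<^sub>R b)) = sgn (f (z + \<psi> t *\<^sub>R b))" if "f \<in> F" for f
      using \<psi>(2)[OF that t(1)] P(2)[OF that] by simp
    then have "z + \<psi> t *\<^sub>R b \<in> A" using det t(2) by blast
    then show ?thesis using order_bij_mem[OF \<psi>(1) t(1)] by (auto simp: E_def)
  qed
  have "E = \<Union>{B\<in>\<A>. B \<inter> E \<noteq> {}}"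
  proof
    show "E \<subseteq> \<Union>{B\<in>\<A>. B \<inter> E \<noteq> {}}" using \<A>(2) by blast
    show "\<Union>{B\<in>\<A>. B \<inter> E \<noteq> {}} \<subseteq> E" using sat by blast
  qed
  moreover have "semialgebraic (\<Union>{B\<in>\<A>. B \<inter> E \<noteq> {}})"
    using \<A>(1,3) by (intro semialgebraic_Union) auto
  ultimately show ?thesis unfolding E_def by simp
qed

lemma semialgebraic_cube_projection:
  fixes A :: "'a::euclidean_space set" and b :: "'i \<Rightarrow> 'a"
  assumes "finite I" "semialgebraic A"
  shows "semialgebraic {y. \<exists>t. (\<forall>i\<in>I. t i \<in> {-1..1}) \<and> y + (\<Sum>i\<in>I. t i *\<^sub>R b i) \<in> A}"
  using assms(1)
proof (induction rule: finite_induct)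
  case empty
  then show ?case using assms(2) by simp
next
  case (insert j I)
  let ?E = "\<lambda>I. {y. \<exists>t. (\<forall>i\<in>I. t i \<in> {-1..1}) \<and> y + (\<Sum>i\<in>I. t i *\<^sub>R b i) \<in> A}"
  have "?E (insert j I) = {y. \<exists>s\<in>{-1..1}. y + s *\<^sub>R b j \<in> ?E I}"
  proof (intro set_eqI iffI)
    fix y assume "y \<in> ?E (insert j I)"
    then obtain t where t: "\<forall>i\<in>insert j I. t i \<in> {-1..1}" "y + (\<Sum>i\<in>insert j I. t i *\<^sub>R b i) \<in> A"
      by blast
    then have "(y + t j *\<^sub>R b j) + (\<Sum>i\<in>I. t i *\<^sub>R b i) \<in> A"
      using insert.hyps by (simp add: add.assoc)
    then have "y + t j *\<^sub>R b j \<in> ?E I" using t(1) by blast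
    then show "y \<in> {y. \<exists>s\<in>{-1..1}. y + s *\<^sub>R b j \<in> ?E I}" using t(1) by blast
  next
    fix y assume "y \<in> {y. \<exists>s\<in>{-1..1}. y + s *\<^sub>R b j \<in> ?E I}"
    then obtain s t where st: "s \<in> {-1..1}" "\<forall>i\<in>I. t i \<in> {-1..1}" "y + s *\<^sub>R b j + (\<Sum>i\<in>I. t i *\<^sub>R b i) \<in> A"
      by blast
    have "(\<Sum>i\<in>insert j I. (t(j := s)) i *\<^sub>R b i) = s *\<^sub>R b j + (\<Sum>i\<in>I. t i *\<^sub>R b i)"
      using insert.hyps by (simp, intro sum.cong) auto
    then have "y + (\<Sum>i\<in>insert j I. (t(j := s)) i *\<^sub>R b i) \<in> A" using st(3) by (simp add: add.assoc)
    moreover have "\<forall>i\<in>insert j I. (t(j := s)) i \<in> {-1..1}" using st(1,2) by simp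
    ultimately show "y \<in> ?E (insert j I)" by blast
  qed
  then show ?case using semialgebraic_segment_projection[OF insert.IH] by simp
qed

lemma semialgebraic_vimage:
  fixes g :: "'a::euclidean_space \<Rightarrow> 'b::euclidean_space"
  assumes "semialgebraic A" "polynomial_function g"
  shows "semialgebraic (g -` A)"
  using assms(1)
proof (induction rule: semialgebraic.induct)
  case (zero f)
  then show ?case using semialgebraic.zero[OF real_polynomial_function_compose[OF assms(2) zero]]
    by (simp add: vimage_def)
next
  case (pos f)
  then show ?case using semialgebraic.pos[OF real_polynomial_function_compose[OF assms(2) pos]]
    by (simp add: vimage_def)
qed (auto simp: vimage_Compl intro: semialgebraic.intros)

lemma real_polynomial_function_component:
  assumes "polynomial_function (F :: 'a::real_normed_vector \<Rightarrow> real^'n)"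
  shows "real_polynomial_function (\<lambda>x. F x $ i)"
  using assms bounded_linear_vec_nth[of i] unfolding polynomial_function_def o_def by blast

text \<open>
  The image is the projection of the graph over the ball. All points of the ball have coordinates in
  \<open>[-1,1]\<close>, so projections along bounded segments suffice. Projecting away every coordinate of the
  source leaves a set in the product space whose slice over \<open>0\<close> is the image.
\<close>

theorem semialgebraic_polynomial_image_ball:
  fixes F :: "real^'m \<Rightarrow> real^'n"
  assumes "polynomial_function F"
  shows "semialgebraic (F ` cball 0 1)"
proof -
  define A where "A = {z. (\<Sum>j\<in>UNIV. (fst z $ j)\<^sup>2) \<le> 1 \<and> (\<forall>i\<in>UNIV. snd z $ i - F (fst z) $ i = 0)}"
  have fstj: "real_polynomial_function (\<lambda>z::(real^'m) \<times> (real^'n). fst z $ j)" for j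
    by (intro rpf_linear bounded_linear_compose[OF bounded_linear_vec_nth bounded_linear_fst])
  have sndi: "real_polynomial_function (\<lambda>z::(real^'m) \<times> (real^'n). snd z $ i)" for i
    by (intro rpf_linear bounded_linear_compose[OF bounded_linear_vec_nth bounded_linear_snd])
  have pfst: "polynomial_function (fst :: (real^'m) \<times> (real^'n) \<Rightarrow> real^'m)"
    by (intro polynomial_function_bounded_linear bounded_linear_fst)
  have Fi: "real_polynomial_function (\<lambda>z::(real^'m) \<times> (real^'n). F (fst z) $ i)" for i
    using real_polynomial_function_compose[OF pfst real_polynomial_function_component[OF assms, of i]]
    by (simp add: o_def)
  have "A = - {z. (\<Sum>j\<in>UNIV. (fst z $ j)\<^sup>2) - 1 > 0} \<inter> {z. \<forall>i\<in>UNIV. snd z $ i - F (fst z) $ i = 0}"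
    by (auto simp: A_def)
  also have "semialgebraic \<dots>"
    by (intro semialgebraic.inter semialgebraic.compl semialgebraic.pos semialgebraic_Collect_ball
        semialgebraic.zero real_polynomial_function_diff real_polynomial_function_sum
        real_polynomial_function_power fstj sndi Fi rpf_const finite)
  finally have A: "semialgebraic A" .
  have Aiff: "(x, y) \<in> A \<longleftrightarrow> x \<in> cball 0 1 \<and> y = F x" for x y
    by (auto simp: A_def norm_vec_def L2_set_def vec_eq_iff)
  define E where "E = {z. \<exists>t. (\<forall>j\<in>UNIV. t j \<in> {-1..1}) \<and> z + (\<Sum>j\<in>UNIV. t j *\<^sub>R (axis j 1, 0)) \<in> A}"
  have E: "semialgebraic E" unfolding E_def by (intro semialgebraic_cube_projection A finite)
  have sm: "(0, y) + (\<Sum>j\<in>UNIV. t j *\<^sub>R (axis j 1, 0)) = (\<chi> j. t j, y)" for t :: "'m \<Rightarrow> real" and y :: "real^'n"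
  proof -
    have "(\<Sum>j\<in>UNIV. t j *\<^sub>R (axis j 1 :: real^'m)) = (\<chi> j. t j)"
      using basis_expansion[of "\<chi> j. t j"] by (simp add: scalar_mult_eq_scaleR)
    then show ?thesis by (simp add: prod_eq_iff fst_sum snd_sum)
  qed
  have "F ` cball 0 1 = Pair 0 -` E"
  proof (intro set_eqI iffI)
    fix y assume "y \<in> F ` cball 0 1"
    then obtain x where x: "x \<in> cball 0 1" "y = F x" by blast
    have "\<bar>x $ j\<bar> \<le> 1" for j using x(1) component_le_norm_cart[of x j] by simp
    then have "\<forall>j\<in>UNIV. x $ j \<in> {-1..1}" by (auto simp: abs_le_iff minus_le_iff)
    moreover have "(0, y) + (\<Sum>j\<in>UNIV. (x $ j) *\<^sub>R (axis j 1, 0)) \<in> A"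
      using sm[of y "\<lambda>j. x $ j"] Aiff x by simp
    ultimately show "y \<in> Pair 0 -` E" unfolding E_def by blast
  next
    fix y assume "y \<in> Pair 0 -` E"
    then show "y \<in> F ` cball 0 1" unfolding E_def using sm Aiff by auto
  qed
  moreover have "polynomial_function (Pair (0::real^'m) :: real^'n \<Rightarrow> _)"
    by (intro polynomial_function_bounded_linear bounded_linear_Pair bounded_linear_zero bounded_linear_ident)
  ultimately show ?thesis using semialgebraic_vimage[OF E] by metis
qed

section \<open>Dimension\<close>

text \<open>
  A ball inside \<open>S\<close> contains a scaled translate of the full open cube, so the largest conceivable
  dimension is attained.
\<close>

lemma semialgebraic_dim_interior:
  fixes S :: "(real^'n::finite) set"
  assumes "interior S \<noteq> {}"
  shows "semialgebraic_dim S = int CARD('n)"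
proof -
  let ?D = "{card K |K :: 'n set. \<exists>f :: real^'n \<Rightarrow> real^'n.
       semialgebraic_map_on (open_cube K) f \<and> inj_on f (open_cube K) \<and> f ` open_cube K \<subseteq> S}"
  obtain p e where e: "e > 0" "ball p e \<subseteq> S"
    using assms by (meson ex_in_conv mem_interior)
  (* Points of the unit cube have norm at most CARD('n); the factor 2 gives a strict inequality. *)
  define \<delta> where "\<delta> = e / (2 * real CARD('n))"
  have \<delta>: "\<delta> > 0" using e by (simp add: \<delta>_def)
  define f where "f = (\<lambda>x::real^'n. p + \<delta> *\<^sub>R x)"
  have "f x \<in> S" if x: "x \<in> open_cube UNIV" for x
  proof -
    have "norm x \<le> (\<Sum>i\<in>UNIV. \<bar>x $ i\<bar>)" by (rule norm_le_l1_cart)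
    also have "\<dots> \<le> (\<Sum>i\<in>(UNIV::'n set). 1)" 
      using x by (intro sum_mono) (auto simp: open_cube_def abs_of_pos less_imp_le)
    finally have "norm x \<le> real CARD('n)" by simp
    then have "\<delta> * norm x \<le> \<delta> * real CARD('n)" using \<delta> by (intro mult_left_mono) auto
    also have "\<dots> < e" using e by (simp add: \<delta>_def)
    finally show ?thesis using e(2) \<delta> by (auto simp: f_def dist_norm)
  qed
  moreover have "inj_on f (open_cube UNIV)" using \<delta> by (auto simp: f_def inj_on_def)
  moreover have "semialgebraic_map_on (open_cube UNIV) f"
  proof -
    have fsti: "real_polynomial_function (\<lambda>z::(real^'n) \<times> (real^'n). fst z $ i)" for i
      by (intro rpf_linear bounded_linear_compose[OF bounded_linear_vec_nth bounded_linear_fst])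
    have sndi: "real_polynomial_function (\<lambda>z::(real^'n) \<times> (real^'n). snd z $ i)" for i
      by (intro rpf_linear bounded_linear_compose[OF bounded_linear_vec_nth bounded_linear_snd])
    have "{(x, f x) |x. x \<in> open_cube UNIV} =
      {z. \<forall>i\<in>UNIV. fst z $ i > 0} \<inter> {z. \<forall>i\<in>UNIV. 1 - fst z $ i > 0}
        \<inter> {z. \<forall>i\<in>UNIV. snd z $ i - (p $ i + \<delta> * fst z $ i) = 0}"
      by (auto simp: open_cube_def f_def vec_eq_iff)
    also have "semialgebraic \<dots>"
      by (intro semialgebraic.inter semialgebraic_Collect_ball semialgebraic.pos semialgebraic.zero
          real_polynomial_function_diff rpf_add rpf_mult rpf_const fsti sndi finite)
    finally show ?thesis by (simp add: semialgebraic_map_on_def)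
  qed
  ultimately have "CARD('n) \<in> ?D" by blast
  moreover have bound: "k \<le> CARD('n)" if "k \<in> ?D" for k using that by (auto intro: card_mono)
  moreover have "finite ?D" using bound by (auto intro: finite_subset[of _ "{..CARD('n)}"])
  ultimately have "Max ?D = CARD('n)" by (intro Max_eqI) auto
  moreover have "S \<noteq> {}" using assms interior_subset by blast
  ultimately show ?thesis by (simp add: semialgebraic_dim_def)
qed

section \<open>Radial contraction\<close>

lemma origin_is_endpoint_of_ray_section:
  fixes p v :: "'a::euclidean_space"
  assumes "ray p v \<inter> S = closed_segment a b" "p \<in> S" "v \<noteq> 0"
  shows "a = p \<or> b = p"
proof -
  have "p \<in> ray p v" by (auto simp: ray_def intro: exI[of _ 0])
  then have "p \<in> closed_segment a b" using assms by blast
  then obtain u where u: "0 \<le> u" "u \<le> 1" "p = (1 - u) *\<^sub>R a + u *\<^sub>R b" by (auto simp: in_segment)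
  have "a \<in> ray p v" "b \<in> ray p v" using assms(1) by auto
  then obtain s t where st: "s \<ge> 0" "t \<ge> 0" "a = p + s *\<^sub>R v" "b = p + t *\<^sub>R v" by (auto simp: ray_def)
  have "((1 - u) * s + u * t) *\<^sub>R v = 0" using u(3) st(3,4) by (simp add: algebra_simps)
  then have "(1 - u) * s + u * t = 0" using assms(3) by simp
  then have "(1 - u) * s = 0" "u * t = 0" using u st by (simp_all add: add_nonneg_eq_0_iff)
  then show ?thesis using st by auto
qed

text \<open>
  The ray from \<open>p\<close> through \<open>x\<close> meets \<open>S\<close> in a segment that starts at \<open>p\<close> and contains \<open>x\<close>. Moving \<open>x\<close>
  towards \<open>p\<close> leads into the relative interior of this segment, even if \<open>x\<close> is its other endpoint.
\<close>

lemma strictly_radially_convex_contraction: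
  assumes "strictly_radially_convex S p" "x \<in> S" "0 < t" "t < 1"
  shows "t *\<^sub>R p + (1 - t) *\<^sub>R x \<in> interior S"
proof (cases "x = p")
  case True
  then show ?thesis using assms(1) by (simp add: strictly_radially_convex_def flip: scaleR_add_left)
next
  case False
  have pS: "p \<in> S" using assms(1) interior_subset by (auto simp: strictly_radially_convex_def)
  define v where "v = x - p"
  have "v \<noteq> 0" using False by (simp add: v_def)
  then obtain a b where ab: "ray p v \<inter> S = closed_segment a b" "rel_interior (closed_segment a b) \<subseteq> interior S"
    using assms(1) unfolding strictly_radially_convex_def by blast
  have "\<exists>q. closed_segment a b = closed_segment p q"
    using origin_is_endpoint_of_ray_section[OF ab(1) pS \<open>v \<noteq> 0\<close>] closed_segment_commute by metis
  then obtain q where q: "closed_segment a b = closed_segment p q" by blast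
  have "x \<in> ray p v" unfolding ray_def v_def by (intro CollectI exI[of _ 1]) simp
  then have "x \<in> closed_segment p q" using assms(2) ab(1) q by blast
  then obtain u where u: "0 \<le> u" "u \<le> 1" "x = (1 - u) *\<^sub>R p + u *\<^sub>R q" by (auto simp: in_segment)
  have "u \<noteq> 0" using False u by auto
  have "p \<noteq> q" using u(3) False by (auto simp flip: scaleR_add_left)
  define w where "w = (1 - t) * u"
  have "0 < w" using assms u(1) \<open>u \<noteq> 0\<close> by (simp add: w_def)
  moreover have "w < 1" using assms u(2) by (simp add: w_def) (smt (verit) mult_left_le)
  moreover have "t *\<^sub>R p + (1 - t) *\<^sub>R x = (1 - w) *\<^sub>R p + w *\<^sub>R q"
    by (simp add: u(3) w_def algebra_simps)
  ultimately have "t *\<^sub>R p + (1 - t) *\<^sub>R x \<in> open_segment p q"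
    using \<open>p \<noteq> q\<close> by (auto simp: in_segment)
  then show ?thesis using ab(2) q \<open>p \<noteq> q\<close> by (simp add: rel_interior_closed_segment) blast
qed

section \<open>Monomial form of polynomial functions\<close>

definition monomial :: "('m::finite \<Rightarrow> nat) \<Rightarrow> real^'m \<Rightarrow> real" where
  "monomial \<alpha> x = (\<Prod>j\<in>UNIV. x $ j ^ \<alpha> j)"

lemma monomial_mult: "monomial \<alpha> x * monomial \<beta> x = monomial (\<lambda>j. \<alpha> j + \<beta> j) x"
  by (simp add: monomial_def power_add prod.distrib)

text \<open>
  Sums and products of polynomials in monomial form are sums over other index sets in which an
  exponent can occur repeatedly; grouping equal exponents restores the form.
\<close>

lemma collect_monomials:
  fixes e :: "'k \<Rightarrow> 'm::finite \<Rightarrow> nat"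
  assumes "finite K" "\<And>x. f x = (\<Sum>k\<in>K. c k * monomial (e k) x)"
  shows "\<exists>A a. finite A \<and> (\<forall>x. f x = (\<Sum>\<alpha>\<in>A. a \<alpha> * monomial \<alpha> x))"
proof (intro exI conjI allI)
  show "finite (e ` K)" using assms(1) by simp
  fix x
  have "f x = (\<Sum>\<alpha>\<in>e ` K. \<Sum>k | k \<in> K \<and> e k = \<alpha>. c k * monomial (e k) x)"
    unfolding assms(2) by (rule sum.image_gen[OF assms(1)])
  also have "\<dots> = (\<Sum>\<alpha>\<in>e ` K. (\<Sum>k | k \<in> K \<and> e k = \<alpha>. c k) * monomial \<alpha> x)"
    by (intro sum.cong) (auto simp: sum_distrib_right)
  finally show "f x = (\<Sum>\<alpha>\<in>e ` K. (\<Sum>k | k \<in> K \<and> e k = \<alpha>. c k) * monomial \<alpha> x)" .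
qed

lemma real_polynomial_function_monomials:
  fixes f :: "real^'m \<Rightarrow> real"
  assumes "real_polynomial_function f"
  shows "\<exists>A a. finite A \<and> (\<forall>x. f x = (\<Sum>\<alpha>\<in>A. a \<alpha> * monomial \<alpha> x))"
  using assms
proof (induction rule: real_polynomial_function.induct)
  case (linear f)
  have coord: "monomial (\<lambda>i. if i = j then 1 else 0) x = x $ j" for j and x :: "real^'m"
  proof -
    have "monomial (\<lambda>i. if i = j then 1 else 0) x = (\<Prod>i\<in>UNIV. if i = j then x $ i else 1)"
      unfolding monomial_def by (intro prod.cong) auto
    then show ?thesis by simp
  qed
  have expand: "f x = (\<Sum>j\<in>UNIV. f (axis j 1) * x $ j)" for x
  proof -
    have "f x = f (\<Sum>j\<in>UNIV. x $ j *\<^sub>R axis j 1)"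
      using basis_expansion[of x] by (simp add: scalar_mult_eq_scaleR)
    also have "\<dots> = (\<Sum>j\<in>UNIV. f (axis j 1) * x $ j)"
      using bounded_linear.linear[OF linear] by (simp add: linear_sum linear_scale mult.commute)
    finally show ?thesis .
  qed
  show ?case
  proof (rule collect_monomials)
    show "f x = (\<Sum>j\<in>UNIV. f (axis j 1) * monomial (\<lambda>i. if i = j then 1 else 0) x)" for x
      unfolding coord by (rule expand)
  qed simp
next
  case (const c)
  show ?case by (intro exI[of _ "{\<lambda>_. 0}"] exI[of _ "\<lambda>_. c"]) (simp add: monomial_def)
next
  case (add f g)
  obtain A a where A: "finite A" "\<And>x. f x = (\<Sum>\<alpha>\<in>A. a \<alpha> * monomial \<alpha> x)"
    using add.IH(1) by blast
  obtain B b where B: "finite B" "\<And>x. g x = (\<Sum>\<alpha>\<in>B. b \<alpha> * monomial \<alpha> x)"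
    using add.IH(2) by blast
  show ?case
    by (rule collect_monomials[of "A <+> B" _ "case_sum a b" "case_sum id id"])
       (simp_all add: A B sum.Plus)
next
  case (mult f g)
  obtain A a where A: "finite A" "\<And>x. f x = (\<Sum>\<alpha>\<in>A. a \<alpha> * monomial \<alpha> x)"
    using mult.IH(1) by blast
  obtain B b where B: "finite B" "\<And>x. g x = (\<Sum>\<alpha>\<in>B. b \<alpha> * monomial \<alpha> x)"
    using mult.IH(2) by blast
  show ?case
  proof (rule collect_monomials[of "A \<times> B" _ "\<lambda>(\<alpha>,\<beta>). a \<alpha> * b \<beta>" "\<lambda>(\<alpha>,\<beta>) j. \<alpha> j + \<beta> j"])
    fix x
    have "f x * g x = (\<Sum>(\<alpha>,\<beta>)\<in>A \<times> B. (a \<alpha> * monomial \<alpha> x) * (b \<beta> * monomial \<beta> x))"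
      by (simp add: A B sum_product sum.cartesian_product)
    also have "\<dots> = (\<Sum>k\<in>A \<times> B. (case k of (\<alpha>,\<beta>) \<Rightarrow> a \<alpha> * b \<beta>) * monomial (case k of (\<alpha>,\<beta>) \<Rightarrow> \<lambda>j. \<alpha> j + \<beta> j) x)"
      by (intro sum.cong) (auto simp flip: monomial_mult)
    finally show "f x * g x = (\<Sum>k\<in>A \<times> B. (case k of (\<alpha>,\<beta>) \<Rightarrow> a \<alpha> * b \<beta>) * monomial ((\<lambda>(\<alpha>,\<beta>) j. \<alpha> j + \<beta> j) k) x)"
      by (simp add: case_prod_unfold)
  qed (simp add: A B)
qed

lemma C0_polynomial_interpolation:
  assumes "real_polynomial_function f"
  shows "C0_polynomial_on_ball (\<lambda>(t, x). t * q + (1 - t) * f x)"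
proof -
  obtain A a where A: "finite A" "\<And>x. f x = (\<Sum>\<alpha>\<in>A. a \<alpha> * monomial \<alpha> x)"
    using real_polynomial_function_monomials[OF assms] by blast
  (* The zero exponent carries the summand t * q and may be absent from A. *)
  define B where "B = insert (\<lambda>_. 0) A"
  define c where "c = (\<lambda>\<alpha> t. (if \<alpha> = (\<lambda>_. 0) then t * q else 0) + (1 - t) * (if \<alpha> \<in> A then a \<alpha> else 0))"
  have "t * q + (1 - t) * f x = (\<Sum>\<alpha>\<in>B. c \<alpha> t * (\<Prod>j\<in>UNIV. x $ j ^ \<alpha> j))" for t x
  proof -
    have "(\<Sum>\<alpha>\<in>B. c \<alpha> t * monomial \<alpha> x) = 
       (\<Sum>\<alpha>\<in>B. if \<alpha> = (\<lambda>_. 0) then t * q * monomial \<alpha> x else 0)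
       + (\<Sum>\<alpha>\<in>B. (1 - t) * (if \<alpha> \<in> A then a \<alpha> * monomial \<alpha> x else 0))"
      by (subst sum.distrib[symmetric], intro sum.cong) (auto simp: c_def algebra_simps)
    also have "(\<Sum>\<alpha>\<in>B. if \<alpha> = (\<lambda>_. 0) then t * q * monomial \<alpha> x else 0) = t * q"
      using A(1) by (simp add: B_def monomial_def sum.delta)
    also have "(\<Sum>\<alpha>\<in>B. (1 - t) * (if \<alpha> \<in> A then a \<alpha> * monomial \<alpha> x else 0)) = (1 - t) * f x"
    proof -
      have "(\<Sum>\<alpha>\<in>B. if \<alpha> \<in> A then a \<alpha> * monomial \<alpha> x else 0) = f x"
        unfolding A(2) using A(1) by (intro sum.mono_neutral_cong_right) (auto simp: B_def)
      then show ?thesis by (simp flip: sum_distrib_left)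
    qed
    finally show ?thesis by (simp add: monomial_def)
  qed
  moreover have "finite B" using A(1) by (simp add: B_def)
  moreover have "continuous_on {0..1} (c \<alpha>)" for \<alpha>
    unfolding c_def by (cases "\<alpha> = (\<lambda>_. 0)"; cases "\<alpha> \<in> A") (auto intro!: continuous_intros)
  ultimately show ?thesis unfolding C0_polynomial_on_ball_def by (intro exI[of _ B] exI[of _ c]) auto
qed

section \<open>Radially convex polynomial images of balls are bricks\<close>

theorem lemma2p1:
  fixes S :: "(real^'n::finite) set" and p :: "real^'n"
    and F :: "real^'m::finite \<Rightarrow> real^'n"
  assumes "strictly_radially_convex S p"
    and "polynomial_function F"
    and "S = F ` cball 0 1"
  shows "brick TYPE('m) S"
proof -
  have pI: "p \<in> interior S" using assms(1) by (simp add: strictly_radially_convex_def)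
  define H where "H = (\<lambda>(t, x). t *\<^sub>R p + (1 - t) *\<^sub>R F x)"
  have "H ` ({0} \<times> cball 0 1) = (\<lambda>x. H (0, x)) ` cball 0 1" by auto
  then have H0: "H ` ({0} \<times> cball 0 1) = S" by (simp add: H_def assms(3))
  have H1: "\<forall>x\<in>cball 0 1. H (1, x) = p" by (simp add: H_def)
  have HI: "H ` ({t} \<times> cball 0 1) \<subseteq> interior S" if "t \<in> {0<..<1}" for t
    using that strictly_radially_convex_contraction[OF assms(1)] by (auto simp: H_def assms(3))
  have "H ` ({0..1} \<times> cball 0 1) \<subseteq> S"
  proof (clarify)
    fix t x assume t: "t \<in> {0..1::real}" and x: "(x::real^'m) \<in> cball 0 1"
    consider "t = 0" | "t = 1" | "t \<in> {0<..<1}" using t by force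
    then show "H (t, x) \<in> S"
    proof cases
      case 1 then show ?thesis using H0 x by blast
    next
      case 2 then show ?thesis using H1 x pI interior_subset by auto
    next
      case 3 then show ?thesis using HI[OF 3] x interior_subset by blast
    qed
  qed
  moreover have "continuous_on ({0..1} \<times> cball 0 1) H"
  proof -
    have "continuous_on UNIV F" 
      using continuous_on_polymonial_function[OF assms(2)] by simp
    then have "continuous_on ({0..1} \<times> cball 0 1) (\<lambda>z. F (snd z))"
      by (rule continuous_on_compose2) (auto intro: continuous_intros)
    then show ?thesis unfolding H_def case_prod_unfold by (intro continuous_intros)
  qed
  moreover have "C0_polynomial_on_ball (\<lambda>z. H z $ i)" for i
    using C0_polynomial_interpolation[OF real_polynomial_function_component[OF assms(2)], of "p $ i" i]
    by (simp add: H_def case_prod_unfold)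
  moreover have "semialgebraic S" using semialgebraic_polynomial_image_ball[OF assms(2)] assms(3) by simp
  moreover have "semialgebraic_dim S = int CARD('n)" using pI by (intro semialgebraic_dim_interior) auto
  ultimately show ?thesis unfolding brick_def using H0 H1 HI by blast
qed

end
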